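(* Let $\omega(k)=k^2$, $g_0\in H^1([0,T])$, and let $q$ be the solution of $iq_t+q_{xx}=0$, $x>0$, $t\in(0,T]$, with zero initial data $q(\cdot,0)=0$ and boundary data $q(0,\cdot)=g_0$. Then for every $(s,\tau)\in\overline{\mathbb R^+\times(0,T)}$ (including $(s,\tau)=(0,0)$), as $(x,t)\to(s,\tau)$ with $x>0$, $0<t\le T$, $$q(x,t)=-2g_0(0)\,I_{\omega,0,1}(x,t)-\frac1\pi\int_{\partial D_1^+}e^{iks-i\omega(k)\tau}\,G_{0,0}(k)\,\frac{dk}{ik}+\mathcal O\big(|x-s|^{1/2}+|t-\tau|^{1/4}\big),$$ where $G_{0,0}(k)=\int_0^te^{i\omega(k)s'}g_0'(s')\,ds'$.
   Context: For a fixed $R>0$ let $D_1^+=\{k:\ 0\le\arg k\le\pi/2,\ |k|\ge R\}$; its boundary is oriented with the region on the left, so $\partial D_1^+$ runs from $i\infty$ to $+\infty$, avoiding the origin. Integrals over unbounded contours are limits, as $r\to\infty$, of the integrals over the part of the contour in $\{|k|<r\}$. The solution is given for $x>0$, $0<t\le T$ by $$q(x,t)=\frac1{2\pi}\int_{\partial D_1^+}e^{ikx-i\omega(k)t}\,2k\,\tilde g_0(-\omega(k),t)\,dk,\qquad \tilde g_0(\kappa,t)=\int_0^te^{-i\kappa s}g_0(s)\,ds,$$ and $$I_{\omega,0,1}(x,t)=\frac1{2\pi}\int_{\partial D_1^+}e^{ikx-i\omega(k)t}\frac{dk}{ik}.$$ Note that $G_{0,0}$ depends on $t$ (the same $t$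 as in $q(x,t)$). *)

theory Defs
  imports "HOL-Complex_Analysis.Complex_Analysis" "HOL-Library.Landau_Symbols"
begin

(* g belongs to the Sobolev space H^1([0,T]) (complex-valued, taken to be the continuous
   representative, so that point values such as g 0 make sense) and g' represents its
   derivative: g' is in L^2(0,T) and g is the indefinite Lebesgue integral of g'. *)
definition has_H1_derivative ::
  "real \<Rightarrow> (real \<Rightarrow> complex) \<Rightarrow> (real \<Rightarrow> complex) \<Rightarrow> bool" where
  "has_H1_derivative T g g' \<longleftrightarrow>
     set_borel_measurable lebesgue {0..T} g' \<and>
     set_integrable lebesgue {0..T} (\<lambda>s. (cmod (g' s))\<^sup>2) \<and>
     (\<forall>t\<in>{0..T}. g t = g 0 + (LINT s:{0..t}|lebesgue. g' s))"

(* The part in |k| < r (for r > R) of the boundary of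
   D_1^+ = {k. 0 <= Arg k <= pi/2, |k| >= R}, with D_1^+ on the left:
   from i r down to i R, clockwise along |k| = R to R, then along the real axis to r. *)
definition bdry_D1 :: "real \<Rightarrow> real \<Rightarrow> real \<Rightarrow> complex" where
  "bdry_D1 R r =
     linepath (\<i> * of_real r) (\<i> * of_real R) +++
     part_circlepath 0 R (pi / 2) 0 +++
     linepath (of_real R) (of_real r)"

definition D1_convergent :: "real \<Rightarrow> (complex \<Rightarrow> complex) \<Rightarrow> bool" where
  "D1_convergent R f \<longleftrightarrow>
     (\<forall>r>R. f contour_integrable_on bdry_D1 R r) \<and>
     (\<exists>L. ((\<lambda>r. contour_integral (bdry_D1 R r) f) \<longlongrightarrow> L) at_top)"

(* Meaningful only if D1_convergent R f. *)
definition D1_integral :: "real \<Rightarrow> (complex \<Rightarrow> complex) \<Rightarrow> complex" where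
  "D1_integral R f = Lim at_top (\<lambda>r. contour_integral (bdry_D1 R r) f)"

definition omega :: "complex \<Rightarrow> complex" where
  "omega k = k\<^sup>2"

definition g_tilde :: "(real \<Rightarrow> complex) \<Rightarrow> complex \<Rightarrow> real \<Rightarrow> complex" where
  "g_tilde g \<kappa> t = (LINT s:{0..t}|lebesgue. exp (- \<i> * \<kappa> * of_real s) * g s)"

definition q_integrand :: "(real \<Rightarrow> complex) \<Rightarrow> real \<Rightarrow> real \<Rightarrow> complex \<Rightarrow> complex" where
  "q_integrand g x t k =
     exp (\<i> * k * of_real x - \<i> * omega k * of_real t) * (2 * k * g_tilde g (- omega k) t)"

(* The solution of i q_t + q_xx = 0 on x > 0, 0 < t <= T with q(.,0) = 0 and q(0,.) = g,
   defined by its integral representation (the boundary datum need not satisfy g 0 = 0, so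
   q is in general not continuous at the corner). *)
definition q_sol :: "real \<Rightarrow> (real \<Rightarrow> complex) \<Rightarrow> real \<Rightarrow> real \<Rightarrow> complex" where
  "q_sol R g x t = 1 / (2 * of_real pi) * D1_integral R (q_integrand g x t)"

definition I_integrand :: "real \<Rightarrow> real \<Rightarrow> complex \<Rightarrow> complex" where
  "I_integrand x t k =
     exp (\<i> * k * of_real x - \<i> * omega k * of_real t) * (1 / (\<i> * k))"

(* I_{omega,0,1}(x,t) *)
definition I_omega_0_1 :: "real \<Rightarrow> real \<Rightarrow> real \<Rightarrow> complex" where
  "I_omega_0_1 R x t = 1 / (2 * of_real pi) * D1_integral R (I_integrand x t)"

(* G_{0,0}(k), with its dependence on t made explicit; g' is the derivative of the datum. *)
definition G_0_0 :: "(real \<Rightarrow> complex) \<Rightarrow> real \<Rightarrow> complex \<Rightarrow> complex" where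
  "G_0_0 g' t k = (LINT s:{0..t}|lebesgue. exp (\<i> * omega k * of_real s) * g' s)"

definition G_integrand ::
  "(real \<Rightarrow> complex) \<Rightarrow> real \<Rightarrow> real \<Rightarrow> real \<Rightarrow> complex \<Rightarrow> complex" where
  "G_integrand g' t s \<tau> k =
     exp (\<i> * k * of_real s - \<i> * omega k * of_real \<tau>) * G_0_0 g' t k * (1 / (\<i> * k))"

end

theory Submission
  imports Defs "HOL-Probability.Characteristic_Functions"
begin

text \<open>
  Write \<open>G\<close> for \<open>G_0_0 g0' t\<close>. Integrating \<open>g_tilde\<close> by parts turns the factor
  \<open>2 k g_tilde g0 (- omega k) t\<close> of the integrand of \<open>q\<close> into
  \<open>2 (exp (\<i> k\<^sup>2 t) g0 t - g0 0 - G k) / (\<i> k)\<close>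
  (\<open>integration_by_parts_exp\<close>). The three terms contribute as follows. The first leaves
  \<open>exp (\<i> k x) / (\<i> k)\<close>, whose contour integral vanishes because the contour can be pushed to
  infinity inside the quadrant (\<open>has_D1_integral_exp_over_k\<close>). The second is
  \<open>- 2 g0 0\<close> times the special function \<open>I\<close>, exactly. The third is the integral in the
  expansion, except that its exponential carries \<open>(x, t)\<close> where the expansion has \<open>(s, \<tau>)\<close>.
  The theorem is thus the claim that the contour integral of \<open>exp (\<i> k x - \<i> k\<^sup>2 t') G k / (\<i> k)\<close>
  is Hoelder continuous in \<open>(x, t')\<close>, uniformly in the \<open>t\<close> on which \<open>G\<close> depends.

  On the closed quadrant the two exponentials differ by at most a constant times
  \<open>\<bar>k\<bar>^(1/2) (\<bar>x - s\<bar>^(1/2) + \<bar>t - \<tau>\<bar>^(1/4))\<close> (\<open>norm_kernel_diff_le\<close>); any power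
  of \<open>\<bar>k\<bar>\<close> below the first would do in what follows. Since
  \<open>2 \<bar>k\<bar>^(1/2) \<bar>G k\<bar> / \<bar>k\<bar> \<le> \<bar>G k\<bar>\<^sup>2 \<bar>k\<bar> + 1 / \<bar>k\<bar>\<^sup>2\<close>, everything is dominated once
  \<open>\<bar>G k\<bar>\<^sup>2 \<bar>k\<bar>\<close> is integrable along both half axes. There \<open>k\<^sup>2 = u\<close> is real, \<open>G\<close> becomes the
  Fourier transform of \<open>g0'\<close> cut off to \<open>[0, t]\<close>, and \<open>\<bar>k\<bar> dk\<close> becomes \<open>du / 2\<close>, so that the
  required bound is the inequality half of Plancherel's theorem (\<open>fourier_L2_bound\<close>). On the arc all
  quantities are bounded (\<open>D1_integral_G_estimates\<close> puts the pieces together).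

  The same domination gives convergence of the integral with \<open>G\<close>. The integral \<open>I\<close> converges only
  conditionally on the real axis, as an integration by parts shows (\<open>D1_convergent_I_integrand\<close>), and
  convergence for \<open>q\<close> is inherited from the decomposition.
\<close>

section \<open>Integration along the boundary of the quadrant\<close>

text \<open>The relational form of \<open>D1_convergent\<close> and \<open>D1_integral\<close>, convenient because linear
  combinations can be formed without carrying convergence separately.\<close>
definition has_D1_integral :: "real \<Rightarrow> (complex \<Rightarrow> complex) \<Rightarrow> complex \<Rightarrow> bool" where
  "has_D1_integral R f L \<longleftrightarrow>
     (\<forall>r>R. f contour_integrable_on bdry_D1 R r) \<and>
     ((\<lambda>r. contour_integral (bdry_D1 R r) f) \<longlongrightarrow> L) at_top"

lemma has_D1_integralD:
  assumes "has_D1_integral R f L"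
  shows "D1_convergent R f" "D1_integral R f = L"
  using assms unfolding has_D1_integral_def D1_convergent_def D1_integral_def
  by (auto intro!: tendsto_Lim)

lemma D1_convergent_imp_has_D1_integral:
  "D1_convergent R f \<Longrightarrow> has_D1_integral R f (D1_integral R f)"
  using has_D1_integralD[of R f] unfolding D1_convergent_def has_D1_integral_def by blast

lemma has_D1_integral_diff:
  assumes "has_D1_integral R f L" "has_D1_integral R g M"
  shows "has_D1_integral R (\<lambda>k. f k - g k) (L - M)"
proof -
  have "\<forall>\<^sub>F r in at_top. contour_integral (bdry_D1 R r) f - contour_integral (bdry_D1 R r) g =
          contour_integral (bdry_D1 R r) (\<lambda>k. f k - g k)"
    using eventually_gt_at_top[of R] 
    by eventually_elim (use assms in \<open>auto simp: has_D1_integral_def contour_integral_diff\<close>)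
  moreover have "((\<lambda>r. contour_integral (bdry_D1 R r) f - contour_integral (bdry_D1 R r) g) \<longlongrightarrow> L - M) at_top"
    using assms by (auto simp: has_D1_integral_def intro: tendsto_diff)
  ultimately have "((\<lambda>r. contour_integral (bdry_D1 R r) (\<lambda>k. f k - g k)) \<longlongrightarrow> L - M) at_top"
    by (rule Lim_transform_eventually[rotated])
  then show ?thesis
    using assms by (auto simp: has_D1_integral_def intro!: contour_integrable_diff)
qed

lemma has_D1_integral_cmult:
  assumes "has_D1_integral R f L"
  shows "has_D1_integral R (\<lambda>k. c * f k) (c * L)"
proof -
  have "\<forall>\<^sub>F r in at_top. c * contour_integral (bdry_D1 R r) f =
          contour_integral (bdry_D1 R r) (\<lambda>k. c * f k)"
    using eventually_gt_at_top[of R]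
    by eventually_elim (use assms in \<open>auto simp: has_D1_integral_def contour_integral_lmul\<close>)
  moreover have "((\<lambda>r. c * contour_integral (bdry_D1 R r) f) \<longlongrightarrow> c * L) at_top"
    using assms by (auto simp: has_D1_integral_def intro: tendsto_mult_left)
  ultimately have "((\<lambda>r. contour_integral (bdry_D1 R r) (\<lambda>k. c * f k)) \<longlongrightarrow> c * L) at_top"
    by (rule Lim_transform_eventually[rotated])
  then show ?thesis
    using assms by (auto simp: has_D1_integral_def intro!: contour_integrable_lmul)
qed

lemma arc_in_quadrant:
  assumes "R > 0" "k \<in> path_image (part_circlepath 0 R (pi / 2) 0)"
  shows "cmod k = R" "Re k \<ge> 0" "Im k \<ge> 0" "k \<noteq> 0"
proof -
  from assms obtain x where x: "x \<in> {0..pi/2}" "k = of_real R * cis x"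
    using pi_ge_zero by (auto simp: path_image_part_circlepath' closed_segment_eq_real_ivl split: if_splits)
  then show "cmod k = R" "Re k \<ge> 0" "Im k \<ge> 0"
    using assms(1) 
    by (auto simp: norm_mult intro!: mult_nonneg_nonneg cos_ge_zero sin_ge_zero)
  then show "k \<noteq> 0" using assms(1) by auto
qed

lemma path_image_bdry_D1:
  assumes "0 < R" "R < r"
  shows "closed_segment (\<i> * of_real r) (\<i> * of_real R) \<subseteq> - {0}"
    and "closed_segment (of_real R) (complex_of_real r) \<subseteq> - {0}"
    and "path_image (part_circlepath 0 R (pi / 2) 0) \<subseteq> - {0}"
    and "path_image (bdry_D1 R r) \<subseteq> - {0}"
proof -
  show 1: "closed_segment (\<i> * of_real r) (\<i> * of_real R) \<subseteq> - {0}"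
    using assms by (auto simp: closed_segment_same_Re closed_segment_eq_real_ivl split: if_splits)
  show 2: "closed_segment (of_real R) (complex_of_real r) \<subseteq> - {0}"
    using assms by (auto simp: closed_segment_same_Im closed_segment_eq_real_ivl split: if_splits)
  show 3: "path_image (part_circlepath 0 R (pi / 2) 0) \<subseteq> - {0}"
    using arc_in_quadrant[OF assms(1)] by blast
  from 1 2 3 show "path_image (bdry_D1 R r) \<subseteq> - {0}"
    unfolding bdry_D1_def by (intro subset_path_image_join) (simp_all only: path_image_linepath)
qed

text \<open>Agreement away from the origin suffices because the contour avoids it; the rewriting of the
  integrand of \<open>q\<close> divides by \<open>k\<close> and is valid only there.\<close>
lemma has_D1_integral_cong:
  assumes "R > 0" "\<And>k. k \<noteq> 0 \<Longrightarrow> f k = g k" "has_D1_integral R g L"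
  shows "has_D1_integral R f L"
proof -
  have eq: "contour_integral (bdry_D1 R r) f = contour_integral (bdry_D1 R r) g"
           "f contour_integrable_on bdry_D1 R r \<longleftrightarrow> g contour_integrable_on bdry_D1 R r"
    if "r > R" for r
  proof -
    have *: "f k = g k" if "k \<in> path_image (bdry_D1 R r)" for k
      using path_image_bdry_D1(4)[OF assms(1) \<open>r > R\<close>] assms(2) that by blast
    show "contour_integral (bdry_D1 R r) f = contour_integral (bdry_D1 R r) g"
      by (rule contour_integral_cong) (use * in auto)
    show "f contour_integrable_on bdry_D1 R r \<longleftrightarrow> g contour_integrable_on bdry_D1 R r"
      using * contour_integrable_eq by metis
  qed
  have "\<forall>\<^sub>F r in at_top. contour_integral (bdry_D1 R r) g = contour_integral (bdry_D1 R r) f"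
    using eventually_gt_at_top[of R] by eventually_elim (simp add: eq)
  from Lim_transform_eventually[OF _ this] show ?thesis
    using assms eq by (auto simp: has_D1_integral_def)
qed

text \<open>The split into the arc and the two half axes is what every estimate below uses. The minus sign comes
  from the imaginary axis being traversed downwards.\<close>
lemma contour_integral_bdry_D1:
  assumes R: "0 < R" "R < r" and f: "continuous_on (- {0}) f"
  shows "f contour_integrable_on bdry_D1 R r"
    and "contour_integral (bdry_D1 R r) f =
           contour_integral (part_circlepath 0 R (pi / 2) 0) f +
           integral {R..r} (\<lambda>y. f (of_real y)) - \<i> * integral {R..r} (\<lambda>y. f (\<i> * of_real y))"
proof -
  let ?a = "part_circlepath 0 R (pi / 2) 0"
  have ends: "pathstart ?a = \<i> * of_real R" "pathfinish ?a = of_real R"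
    using cis_pi_half by (simp_all add: cis_conv_exp)
  have int: "f contour_integrable_on linepath (\<i> * of_real r) (\<i> * of_real R)"
       "f contour_integrable_on ?a" "f contour_integrable_on linepath (of_real R) (of_real r)"
    using path_image_bdry_D1[OF R]
    by (intro contour_integrable_continuous_linepath
        contour_integrable_continuous_part_circlepath continuous_on_subset[OF f]; simp)+
  let ?p = "?a +++ linepath (of_real R) (of_real r)"
  have "valid_path ?p"
    by (intro valid_path_join valid_path_linepath valid_path_part_circlepath) simp
  moreover have "f contour_integrable_on ?p"
    by (intro contour_integrable_joinI int valid_path_linepath valid_path_part_circlepath)
  ultimately have p: "valid_path ?p" "f contour_integrable_on ?p" .
  show "f contour_integrable_on bdry_D1 R r"
    unfolding bdry_D1_def by (intro contour_integrable_joinI int p valid_path_linepath)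
  have 1: "contour_integral (bdry_D1 R r) f =
     contour_integral (linepath (\<i> * of_real r) (\<i> * of_real R)) f + contour_integral ?a f
      + contour_integral (linepath (of_real R) (of_real r)) f"
    unfolding bdry_D1_def
      contour_integral_join[OF int(1) p(2) valid_path_linepath p(1)]
      contour_integral_join[OF int(2,3) valid_path_part_circlepath valid_path_linepath]
    by (rule add.assoc[symmetric])
  have 2: "contour_integral (linepath (of_real R) (of_real r)) f = integral {R..r} (\<lambda>y. f (of_real y))"
    using R by (subst contour_integral_linepath_Reals_eq) auto
  have "contour_integral (linepath (\<i> * of_real r) (\<i> * of_real R)) f
     = - contour_integral (linepath (\<i> * of_real R) (\<i> * of_real r)) f"
    using contour_integral_reversepath[of "linepath (\<i> * of_real R) (\<i> * of_real r)" f] by simp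
  also have "contour_integral (linepath (\<i> * of_real R) (\<i> * of_real r)) f
     = \<i> * integral {R..r} (\<lambda>y. f (\<i> * of_real y))"
    using R contour_integral_linepath_same_Re[of "\<i> * of_real R" 0 "\<i> * of_real r" R r f] 
    by (simp add: Complex_eq)
  finally show "contour_integral (bdry_D1 R r) f =
           contour_integral ?a f +
           integral {R..r} (\<lambda>y. f (of_real y)) - \<i> * integral {R..r} (\<lambda>y. f (\<i> * of_real y))"
    unfolding 1 2 by simp
qed

lemma continuous_on_axes:
  fixes f :: "complex \<Rightarrow> complex"
  assumes "continuous_on (- {0}) f" "0 < R"
  shows "continuous_on {R..r} (\<lambda>y. f (of_real y))" "continuous_on {R..r} (\<lambda>y. f (\<i> * of_real y))"
  using assms(2) by (auto intro!: continuous_on_compose2[OF assms(1)] continuous_intros)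

lemma norm_contour_integral_bdry_D1_le:
  assumes R: "0 < R" "R < r" and f: "continuous_on (- {0}) f"
    and W: "continuous_on {R..r} W"
    and arc: "\<And>k. cmod k = R \<Longrightarrow> Re k \<ge> 0 \<Longrightarrow> Im k \<ge> 0 \<Longrightarrow> cmod (f k) \<le> A" and A: "A \<ge> 0"
    and axes: "\<And>y. y \<in> {R..r} \<Longrightarrow> cmod (f (of_real y)) \<le> W y"
              "\<And>y. y \<in> {R..r} \<Longrightarrow> cmod (f (\<i> * of_real y)) \<le> W y"
  shows "cmod (contour_integral (bdry_D1 R r) f) \<le> A * R * (pi / 2) + 2 * integral {R..r} W"
proof -
  let ?a = "part_circlepath 0 R (pi / 2) 0"
  have "f contour_integrable_on ?a"
    using arc_in_quadrant[OF R(1)] f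
    by (intro contour_integrable_continuous_part_circlepath continuous_on_subset[OF f]) auto
  then have 1: "cmod (contour_integral ?a f) \<le> A * R * (pi / 2)"
    using contour_integral_bound_part_circlepath[of f 0 R "pi/2" 0 A] arc_in_quadrant[OF R(1)] arc A R
    by auto
  have 2: "cmod (integral {R..r} (\<lambda>y. f (of_real y))) \<le> integral {R..r} W"
          "cmod (integral {R..r} (\<lambda>y. f (\<i> * of_real y))) \<le> integral {R..r} W"
    by (intro integral_norm_bound_integral integrable_continuous_interval continuous_on_axes f R W axes;
        assumption)+
  have "cmod (contour_integral (bdry_D1 R r) f) \<le> cmod (contour_integral ?a f) +
      cmod (integral {R..r} (\<lambda>y. f (of_real y))) + cmod (\<i> * integral {R..r} (\<lambda>y. f (\<i> * of_real y)))"
    unfolding contour_integral_bdry_D1(2)[OF R f]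
    by (rule order_trans[OF norm_triangle_ineq4]) (intro add_mono norm_triangle_ineq order_refl)
  with 1 2 show ?thesis by (simp add: norm_mult)
qed

text \<open>A Cauchy criterion: the partial integrals of the dominating function increase to a finite supremum,
  so their increments control those of \<open>f\<close>.\<close>
lemma improper_integral_dominated:
  fixes f :: "real \<Rightarrow> complex"
  assumes f: "\<And>r. continuous_on {R..r} f" and W: "\<And>r. continuous_on {R..r} W"
    and le: "\<And>y. y \<ge> R \<Longrightarrow> cmod (f y) \<le> W y"
    and C: "\<And>r. r > R \<Longrightarrow> integral {R..r} W \<le> C"
  shows "\<exists>L. ((\<lambda>r. integral {R..r} f) \<longlongrightarrow> L) at_top"
proof -
  define P where "P r = integral {R..r} W" for r
  define F where "F r = integral {R..r} f" for r
  have diff: "cmod (F b - F a) \<le> P b - P a" if "R < a" "a \<le> b" for a b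
  proof -
    have sub: "continuous_on {a..b} f" "continuous_on {a..b} W"
      using f[of b] W[of b] that by (auto intro: continuous_on_subset)
    have "F a + integral {a..b} f = F b" "P a + integral {a..b} W = P b"
      unfolding F_def P_def using that f[of b] W[of b]
      by (auto intro!: Henstock_Kurzweil_Integration.integral_combine integrable_continuous_interval)
    moreover have "cmod (integral {a..b} f) \<le> integral {a..b} W"
      using that sub by (intro integral_norm_bound_integral integrable_continuous_interval le) auto
    ultimately show ?thesis by (metis add_diff_cancel_left')
  qed
  define S where "S = (SUP r\<in>{R<..}. P r)"
  have bdd: "bdd_above (P ` {R<..})" using C by (auto simp: P_def intro!: bdd_aboveI)
  have PS: "P r \<le> S" if "r > R" for r
    unfolding S_def using bdd that by (intro cSUP_upper) auto
  have "cauchy_filter (filtermap F at_top)"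
    unfolding cauchy_filter_metric_filtermap
  proof (intro allI impI)
    fix e :: real assume "e > 0"
    have "\<exists>a\<in>{R<..}. S - e / 2 < P a"
      using less_cSUP_iff[OF _ bdd, of "S - e/2"] \<open>e > 0\<close> unfolding S_def[symmetric] by auto
    then obtain a where a: "a > R" "S - e / 2 < P a" by auto
    have near: "cmod (F b - F a) < e / 2" if "b \<ge> a" for b
      using diff[OF a(1) that] PS[of b] a that by linarith
    show "\<exists>Q. eventually Q at_top \<and> (\<forall>x y. Q x \<and> Q y \<longrightarrow> dist (F x) (F y) < e)"
    proof (intro exI conjI allI impI)
      show "eventually (\<lambda>x. x \<ge> a) at_top" by (rule eventually_ge_at_top)
      fix x y assume "a \<le> x \<and> a \<le> y"
      then have "dist (F x) (F a) < e / 2" "dist (F y) (F a) < e / 2" using near by (auto simp: dist_norm)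
      then show "dist (F x) (F y) < e" by (rule dist_triangle_half_l)
    qed
  qed
  then have "convergent_filter (filtermap F at_top)"
    by (intro cauchy_filter_convergent) (auto simp: filtermap_bot_iff)
  then show ?thesis
    unfolding convergent_filter_iff filterlim_def F_def by blast
qed

lemma D1_convergentI:
  assumes R: "0 < R" and f: "continuous_on (- {0}) f"
    and 1: "((\<lambda>r. integral {R..r} (\<lambda>y. f (of_real y))) \<longlongrightarrow> L1) at_top"
    and 2: "((\<lambda>r. integral {R..r} (\<lambda>y. f (\<i> * of_real y))) \<longlongrightarrow> L2) at_top"
  shows "D1_convergent R f"
  unfolding D1_convergent_def
proof (intro conjI exI allI impI)
  show "f contour_integrable_on bdry_D1 R r" if "r > R" for r
    using contour_integral_bdry_D1(1)[OF R that f] .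
  let ?A = "contour_integral (part_circlepath 0 R (pi / 2) 0) f"
  have "\<forall>\<^sub>F r in at_top. ?A + integral {R..r} (\<lambda>y. f (of_real y)) - \<i> * integral {R..r} (\<lambda>y. f (\<i> * of_real y))
     = contour_integral (bdry_D1 R r) f"
    using eventually_gt_at_top[of R] by eventually_elim (simp add: contour_integral_bdry_D1(2)[OF R _ f])
  moreover have "((\<lambda>r. ?A + integral {R..r} (\<lambda>y. f (of_real y)) - \<i> * integral {R..r} (\<lambda>y. f (\<i> * of_real y)))
     \<longlongrightarrow> ?A + L1 - \<i> * L2) at_top"
    by (intro tendsto_intros 1 2)
  ultimately show "((\<lambda>r. contour_integral (bdry_D1 R r) f) \<longlongrightarrow> ?A + L1 - \<i> * L2) at_top"
    by (rule Lim_transform_eventually[rotated])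
qed

lemma integral_inverse_square_le:
  assumes "0 < R" "R < r"
  shows "integral {R..r} (\<lambda>y. 1 / y\<^sup>2) \<le> (1 / R :: real)"
proof -
  have "((\<lambda>y. 1 / y\<^sup>2) has_integral (- (1 / r) - - (1 / R))) {R..r}"
    using assms
    by (intro fundamental_theorem_of_calculus)
       (auto simp: has_real_derivative_iff_has_vector_derivative[symmetric] power2_eq_square
             intro!: derivative_eq_intros)
  then show ?thesis using assms by (simp add: integral_unique)
qed

lemma improper_integral_inverse_square:
  fixes f :: "real \<Rightarrow> complex"
  assumes R: "0 < R" and f: "\<And>r. continuous_on {R..r} f"
    and le: "\<And>y. y \<ge> R \<Longrightarrow> cmod (f y) \<le> c / y\<^sup>2"
  shows "\<exists>L. ((\<lambda>r. integral {R..r} f) \<longlongrightarrow> L) at_top"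
proof (rule improper_integral_dominated[OF f])
  have "0 \<le> c / R\<^sup>2" using le[of R] norm_ge_zero order_trans by blast
  then have "c \<ge> 0" using R by (simp add: zero_le_divide_iff)
  show "integral {R..r} (\<lambda>y. c / y\<^sup>2) \<le> c * (1 / R)" if "R < r" for r
    using mult_left_mono[OF integral_inverse_square_le[OF R that] \<open>c \<ge> 0\<close>]
    by (simp flip: integral_mult_right)
  show "continuous_on {R..r} (\<lambda>y. c / y\<^sup>2)" for r
    using R by (auto intro!: continuous_intros)
qed (rule le)

section \<open>The two explicit contour integrals\<close>

text \<open>A form of Jordan's inequality. Since \<open>sin + cos \<ge> 1\<close> on the quarter circle, the integrand splits
  into \<open>cos t * exp (- c * sin t)\<close>, which has a primitive, and \<open>sin t * exp (- c * sin t)\<close>, which is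
  at most \<open>1 / c\<close>.\<close>
lemma integral_exp_sin_le:
  assumes c: "c > 0"
  shows "integral {0..pi/2} (\<lambda>t. exp (- c * sin t)) \<le> (pi / 2 + 1) / c"
proof -
  let ?W = "\<lambda>t. 1 / c + cos t * exp (- c * sin t)"
  have W: "(?W has_integral ((pi/2) / c - exp (- c * sin (pi/2)) / c) - (0 / c - exp (- c * sin 0) / c)) {0..pi/2}"
    using c
    by (intro fundamental_theorem_of_calculus)
       (auto simp: has_real_derivative_iff_has_vector_derivative[symmetric] field_simps
             intro!: derivative_eq_intros)
  have le: "exp (- c * sin t) \<le> ?W t" if "t \<in> {0..pi/2}" for t
  proof -
    have s: "0 \<le> sin t" "0 \<le> cos t" using that by (auto intro!: sin_ge_zero cos_ge_zero)
    have "(sin t)\<^sup>2 \<le> sin t" "(cos t)\<^sup>2 \<le> cos t"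
      using s by (auto simp: power2_eq_square mult_left_le)
    then have 1: "1 \<le> sin t + cos t" using sin_cos_squared_add[of t] by linarith
    have "c * sin t \<le> exp (c * sin t)" using exp_ge_add_one_self[of "c * sin t"] by linarith
    then have 2: "sin t * exp (- c * sin t) \<le> 1 / c"
      using c by (simp add: exp_minus field_simps)
    have "exp (- c * sin t) \<le> (sin t + cos t) * exp (- c * sin t)"
      using 1 by simp
    also have "\<dots> \<le> ?W t" using 2 by (simp add: distrib_right)
    finally show ?thesis .
  qed
  have "integral {0..pi/2} (\<lambda>t. exp (- c * sin t)) \<le> integral {0..pi/2} ?W"
    by (intro integral_le le integrable_continuous_interval continuous_intros)
  also have "\<dots> \<le> (pi / 2 + 1) / c"
    using c unfolding integral_unique[OF W] by (simp add: field_simps)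
  finally show ?thesis .
qed

text \<open>Closing the truncated contour by the arc of radius \<open>r\<close> gives a loop in the plane slit along the
  negative real axis, where the integrand is holomorphic; by Jordan's estimate the contribution of that
  arc is of size \<open>1 / r\<close>.\<close>
lemma has_D1_integral_exp_over_k:
  assumes R: "R > 0" and x: "x > 0"
  shows "has_D1_integral R (\<lambda>k. exp (\<i> * k * of_real x) * (1 / (\<i> * k))) 0"
proof -
  let ?f = "\<lambda>k. exp (\<i> * k * of_real x) * (1 / (\<i> * k))"
  let ?S = "- (complex_of_real ` {..0})"
  have cont: "continuous_on (- {0}) ?f" by (auto intro!: continuous_intros)
  have bound: "cmod (contour_integral (bdry_D1 R r) ?f) \<le> (pi / 2 + 1) / (x * r)" if r: "R < r" for r
  proof -
    let ?a = "part_circlepath 0 r 0 (pi/2)"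
    have r0: "r > 0" using R r by simp
    have end1: "pathstart (part_circlepath 0 R (pi/2) 0) = \<i> * of_real R" for R
      using cis_pi_half by (simp add: cis_conv_exp)
    have end2: "pathfinish ?a = \<i> * of_real r"
      using cis_pi_half by (simp add: cis_conv_exp)
    have valid: "valid_path (bdry_D1 R r)" "pathfinish (bdry_D1 R r) = pathstart ?a"
       "pathstart (bdry_D1 R r) = pathfinish ?a"
      unfolding bdry_D1_def using end1[of R] end2 by (auto intro!: valid_path_join)
    have notneg: "k \<in> ?S" if "Re k \<ge> 0" "k \<noteq> 0" for k
      using that by (auto simp: complex_eq_iff)
    have arcim: "path_image ?a = path_image (part_circlepath 0 r (pi/2) 0)"
      by (metis path_image_reversepath reversepath_part_circlepath)
    have im1: "path_image ?a \<subseteq> ?S"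
      unfolding arcim using arc_in_quadrant[OF r0] notneg by blast
    have "closed_segment (\<i> * of_real r) (\<i> * of_real R) \<subseteq> ?S"
      "closed_segment (of_real R) (complex_of_real r) \<subseteq> ?S"
      using R r
      by (auto simp: closed_segment_same_Re closed_segment_same_Im closed_segment_eq_real_ivl split: if_splits)
    moreover have "path_image (part_circlepath 0 R (pi / 2) 0) \<subseteq> ?S"
      using notneg arc_in_quadrant[OF R] by blast
    ultimately have im2: "path_image (bdry_D1 R r) \<subseteq> ?S"
      unfolding bdry_D1_def by (intro subset_path_image_join) (simp_all only: path_image_linepath)
    have "open ?S" using closed_slot_left[of 0] by (simp add: open_Compl)
    moreover have "?f holomorphic_on ?S"
      by (intro holomorphic_intros) (auto simp: image_iff)
    moreover have "path_image (bdry_D1 R r +++ ?a) \<subseteq> ?S"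
      using im2 im1 by (rule subset_path_image_join)
    ultimately have "(?f has_contour_integral 0) (bdry_D1 R r +++ ?a)"
      using valid by (intro Cauchy_theorem_starlike_simple[of ?S] starlike_slotted_complex_plane_left) auto
    moreover have "(?f has_contour_integral contour_integral (bdry_D1 R r) ?f + contour_integral ?a ?f)
        (bdry_D1 R r +++ ?a)"
    proof (intro has_contour_integral_join has_contour_integral_integral)
      show "?f contour_integrable_on bdry_D1 R r" by (rule contour_integral_bdry_D1(1)[OF R r cont])
      have "path_image ?a \<subseteq> - {0}" using im1 by (auto simp: image_iff)
      then show "?f contour_integrable_on ?a"
        by (intro contour_integrable_continuous_part_circlepath continuous_on_subset[OF cont])
    qed (use valid in auto)
    ultimately have "contour_integral (bdry_D1 R r) ?f + contour_integral ?a ?f = 0"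
      by (rule has_contour_integral_unique[symmetric])
    then have "contour_integral (bdry_D1 R r) ?f = - contour_integral ?a ?f"
      by (rule add_eq_0_iff2[THEN iffD1])
    then have "cmod (contour_integral (bdry_D1 R r) ?f) = cmod (contour_integral ?a ?f)"
      by (simp only: norm_minus_cancel)
    also have "contour_integral ?a ?f = integral {0..pi/2} (\<lambda>t. exp (\<i> * (of_real r * cis t) * of_real x))"
    proof (subst contour_integral_part_circlepath_eq)
      have "exp w * (1 / (\<i> * (0 + of_real r * cis t))) * of_real r * \<i> * cis t = exp w" for t :: real and w
        using r0 cis_neq_zero[of t] by simp
      then show "integral {0..pi/2} (\<lambda>t. ?f (0 + of_real r * cis t) * of_real r * \<i> * cis t) =
          integral {0..pi/2} (\<lambda>t. exp (\<i> * (of_real r * cis t) * of_real x))"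
        by simp
    qed simp
    also have "cmod \<dots> \<le> integral {0..pi/2} (\<lambda>t. exp (- (x * r) * sin t))"
      by (intro integral_norm_bound_integral integrable_continuous_interval continuous_intros)
         (auto simp: cis.sel)
    also have "\<dots> \<le> (pi / 2 + 1) / (x * r)"
      using r0 x by (intro integral_exp_sin_le) auto
    finally show ?thesis .
  qed
  have "((\<lambda>r. (pi / 2 + 1) / (x * r)) \<longlongrightarrow> 0) at_top"
    using x by real_asymp
  moreover have "\<forall>\<^sub>F r in at_top. cmod (contour_integral (bdry_D1 R r) ?f) \<le> (pi / 2 + 1) / (x * r)"
    using eventually_gt_at_top[of R] by eventually_elim (rule bound)
  ultimately have "((\<lambda>r. contour_integral (bdry_D1 R r) ?f) \<longlongrightarrow> 0) at_top"
    by (rule Lim_null_comparison[rotated])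
  then show ?thesis
    unfolding has_D1_integral_def using contour_integral_bdry_D1(1)[OF R _ cont] by blast
qed

text \<open>On the imaginary axis the integrand decays exponentially. On the real axis it is only of size
  \<open>1 / k\<close>, and one integrates by parts through \<open>H k = E k / (2 t k\<^sup>2)\<close>, i.e. against the primitive of
  \<open>k exp (- \<i> k\<^sup>2 t)\<close> alone: keeping \<open>exp (\<i> k x)\<close> out of the primitive avoids dividing by the
  derivative of the full phase, which vanishes at \<open>k = x / (2 t)\<close>. The remainder is of size
  \<open>1 / k\<^sup>2\<close>.\<close>
lemma D1_convergent_I_integrand:
  assumes R: "R > 0" and x: "x > 0" and t: "t > 0"
  shows "D1_convergent R (I_integrand x t)"
proof -
  have cont: "continuous_on (- {0}) (I_integrand x t)"
    unfolding I_integrand_def omega_def by (auto intro!: continuous_intros)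
  define E where "E k = exp (\<i> * of_real k * of_real x - \<i> * (of_real k)\<^sup>2 * of_real t)" for k :: real
  have normE: "cmod (E k) = 1" for k
    unfolding E_def by (simp add: power2_eq_square)
  have contE: "continuous_on A E" for A
    unfolding E_def by (intro continuous_intros)
  define rest where "rest k = E k * (\<i> * of_real x / (2 * of_real t * (of_real k)\<^sup>2) - 1 / (of_real t * (of_real k) ^ 3))" for k :: real
  define H where "H k = E k / (2 * of_real t * (of_real k)\<^sup>2)" for k :: real
  have rest_le: "cmod (rest k) \<le> (x / (2 * t) + 1 / (t * R)) / k\<^sup>2" if "k \<ge> R" for k
  proof -
    have k: "k > 0" using that R by simp
    have "cmod (rest k) \<le> x / (2 * t * k\<^sup>2) + 1 / (t * k ^ 3)"
      unfolding rest_def norm_mult normE using x t k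
      by (simp, intro order_trans[OF norm_triangle_ineq4]) (simp add: norm_divide norm_mult norm_power)
    also have "1 / (t * k ^ 3) \<le> 1 / (t * R * k\<^sup>2)"
      using that R t k by (intro divide_left_mono) (auto simp: power3_eq_cube power2_eq_square)
    also have "x / (2 * t * k\<^sup>2) + 1 / (t * R * k\<^sup>2) = (x / (2 * t) + 1 / (t * R)) / k\<^sup>2"
      by (simp add: add_divide_distrib)
    finally show ?thesis by simp
  qed
  have contrest: "continuous_on {R..r} rest" for r
    unfolding rest_def using R t by (intro continuous_intros contE) auto
  obtain L where L: "((\<lambda>r. integral {R..r} rest) \<longlongrightarrow> L) at_top"
    using improper_integral_inverse_square[OF R contrest rest_le] by blast
  have H0: "(H \<longlongrightarrow> 0) at_top"
  proof (rule Lim_null_comparison)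
    show "((\<lambda>r. 1 / (2 * t * r\<^sup>2)) \<longlongrightarrow> 0) at_top" using t by real_asymp
    show "\<forall>\<^sub>F r in at_top. cmod (H r) \<le> 1 / (2 * t * r\<^sup>2)"
      using t by (auto simp: H_def norm_divide norm_mult norm_power normE)
  qed
  have parts: "integral {R..r} (\<lambda>k. I_integrand x t (of_real k)) = H r - H R - integral {R..r} rest"
    if "R < r" for r
  proof -
    have "((\<lambda>k. I_integrand x t (of_real k) + rest k) has_integral (H r - H R)) {R..r}"
    proof (rule fundamental_theorem_of_calculus)
      fix k assume "k \<in> {R..r}"
      then have k: "k \<noteq> 0" using R by auto
      have E': "(E has_vector_derivative E k * (\<i> * of_real x - 2 * \<i> * of_real k * of_real t)) (at k within {R..r})"
        unfolding E_def
        by (rule has_vector_derivative_real_field[where f = "\<lambda>z. exp (\<i> * z * of_real x - \<i> * z\<^sup>2 * of_real t)"])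
           (auto intro!: derivative_eq_intros)
      have P': "((\<lambda>k. 1 / (2 * of_real t * (of_real k)\<^sup>2) :: complex) has_vector_derivative
          - 1 / (of_real t * (of_real k) ^ 3)) (at k within {R..r})"
        by (rule has_vector_derivative_real_field[where f = "\<lambda>z. 1 / (2 * of_real t * z\<^sup>2)"])
           (use k t in \<open>auto intro!: derivative_eq_intros simp: field_simps power2_eq_square power3_eq_cube\<close>)
      \<comment> \<open>The derivative of the exponential contributes the integrand itself plus the \<open>x\<close>-term of \<open>rest\<close>.\<close>
      have "(H has_vector_derivative E k * (- 1 / (of_real t * (of_real k) ^ 3)) + 
          E k * (\<i> * of_real x - 2 * \<i> * of_real k * of_real t) * (1 / (2 * of_real t * (of_real k)\<^sup>2)))
          (at k within {R..r})"
        using has_vector_derivative_mult[OF E' P'] unfolding H_def by simp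
      also have "E k * (- 1 / (of_real t * (of_real k) ^ 3)) + 
          E k * (\<i> * of_real x - 2 * \<i> * of_real k * of_real t) * (1 / (2 * of_real t * (of_real k)\<^sup>2))
          = E k * (- (\<i> * of_real k * of_real t) / (of_real t * (of_real k)\<^sup>2)) + rest k"
        unfolding rest_def using k t by (simp add: field_simps power2_eq_square power3_eq_cube)
      also have "- (\<i> * of_real k * of_real t) / (of_real t * (of_real k)\<^sup>2) = 1 / (\<i> * complex_of_real k)"
        using k t by (simp add: field_simps power2_eq_square)
      finally show "(H has_vector_derivative I_integrand x t (of_real k) + rest k) (at k within {R..r})"
        unfolding I_integrand_def omega_def E_def .
    qed (use that in simp)
    moreover have "(rest has_integral integral {R..r} rest) {R..r}"
      by (intro integrable_integral integrable_continuous_interval contrest)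
    ultimately have "((\<lambda>k. I_integrand x t (of_real k) + rest k - rest k) has_integral
       (H r - H R - integral {R..r} rest)) {R..r}"
      by (rule has_integral_diff)
    then show ?thesis by (simp add: integral_unique)
  qed
  have "((\<lambda>r. H r - H R - integral {R..r} rest) \<longlongrightarrow> 0 - H R - L) at_top"
    by (intro tendsto_intros H0 L)
  moreover have "\<forall>\<^sub>F r in at_top. H r - H R - integral {R..r} rest = integral {R..r} (\<lambda>k. I_integrand x t (of_real k))"
    using eventually_gt_at_top[of R] by eventually_elim (simp add: parts)
  ultimately have 1: "((\<lambda>r. integral {R..r} (\<lambda>k. I_integrand x t (of_real k))) \<longlongrightarrow> 0 - H R - L) at_top"
    by (rule Lim_transform_eventually)
  have "cmod (I_integrand x t (\<i> * of_real y)) \<le> (1 / x) / y\<^sup>2" if "y \<ge> R" for y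
  proof -
    have y: "y > 0" using that R by simp
    have "x * y \<le> exp (x * y)" using exp_ge_add_one_self[of "x * y"] by linarith
    then have "exp (- (x * y)) / y \<le> (1 / x) / y\<^sup>2"
      using x y by (simp add: exp_minus field_simps power2_eq_square)
    then show ?thesis
      using y by (simp add: I_integrand_def omega_def norm_mult norm_divide power_mult_distrib 
          power2_eq_square mult.commute)
  qed
  then obtain L2 where 2: "((\<lambda>r. integral {R..r} (\<lambda>y. I_integrand x t (\<i> * of_real y))) \<longlongrightarrow> L2) at_top"
    using improper_integral_inverse_square[OF R continuous_on_axes(2)[OF cont R]] by blast
  show ?thesis by (rule D1_convergentI[OF R cont 1 2])
qed

section \<open>A Plancherel inequality\<close>

lemma (in pair_sigma_finite) integrable_pair_dominated:
  fixes f :: "'a \<times> 'b \<Rightarrow> complex" and g :: "'a \<Rightarrow> real" and h :: "'b \<Rightarrow> complex"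
  assumes f: "f \<in> borel_measurable (M1 \<Otimes>\<^sub>M M2)"
    and g: "integrable M1 g" and h: "integrable M2 h"
    and le: "\<And>x y. cmod (f (x, y)) \<le> g x * cmod (h y)"
  shows "integrable (M1 \<Otimes>\<^sub>M M2) f"
proof (rule Bochner_Integration.integrable_bound)
  have [measurable]: "g \<in> borel_measurable M1" "h \<in> borel_measurable M2"
    using g h by auto
  show "integrable (M1 \<Otimes>\<^sub>M M2) (\<lambda>(x, y). g x * cmod (h y))"
    using g h by (intro Fubini_integrable) (auto simp: norm_mult abs_mult)
  show "AE z in M1 \<Otimes>\<^sub>M M2. norm (f z) \<le> norm (case z of (x, y) \<Rightarrow> g x * cmod (h y))"
    using le by (auto intro!: AE_I2 intro: order_trans[OF _ abs_ge_self])
qed (rule f)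

lemma nn_integral_gaussian:
  assumes "B > 0"
  shows "(\<integral>\<^sup>+ y. ennreal (exp (- (B * (x - y))\<^sup>2 / 2)) \<partial>lborel) = ennreal (sqrt (2 * pi) / B)"
proof -
  have eq: "exp (- (B * (x - y))\<^sup>2 / 2) = sqrt (2 * pi) / B * normal_density x (1 / B) y" for y
  proof -
    have "(B * (x - y))\<^sup>2 / 2 = (y - x)\<^sup>2 / (2 * (1 / B)\<^sup>2)"
      by (simp add: power_mult_distrib power_divide power2_commute[of x y])
    moreover have "sqrt (2 * pi * (1 / B)\<^sup>2) = sqrt (2 * pi) / B"
      using assms by (simp add: real_sqrt_mult)
    ultimately show ?thesis
      using assms by (simp add: normal_density_def)
  qed
  have "(\<integral>\<^sup>+ y. ennreal (c * normal_density x (1 / B) y) \<partial>lborel)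
     = ennreal c * (\<integral>\<^sup>+ y. ennreal (normal_density x (1 / B) y) \<partial>lborel)" if "c \<ge> 0" for c
    using that by (simp add: ennreal_mult' nn_integral_cmult)
  from this[of "sqrt (2 * pi) / B"]
  have "(\<integral>\<^sup>+ y. ennreal (exp (- (B * (x - y))\<^sup>2 / 2)) \<partial>lborel)
     = ennreal (sqrt (2 * pi) / B) * (\<integral>\<^sup>+ y. ennreal (normal_density x (1 / B) y) \<partial>lborel)"
    unfolding eq using assms by simp
  also have "(\<integral>\<^sup>+ y. ennreal (normal_density x (1 / B) y) \<partial>lborel) = 1"
    using assms by (subst nn_integral_eq_integral) auto
  finally show ?thesis by simp
qed

text \<open>Schur's test for the Gaussian kernel: bound \<open>\<bar>h x\<bar> \<bar>h y\<bar>\<close> by half the sum of the squares and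
  integrate out the free variable.\<close>
lemma nn_integral_gaussian_form_le:
  fixes h :: "real \<Rightarrow> complex"
  assumes h[measurable]: "h \<in> borel_measurable lborel" and B: "B > 0"
    and h2: "integrable lborel (\<lambda>s. (cmod (h s))\<^sup>2)"
  shows "(\<integral>\<^sup>+ x. \<integral>\<^sup>+ y. ennreal (cmod (h x) * cmod (h y) * exp (- (B * (x - y))\<^sup>2 / 2)) \<partial>lborel \<partial>lborel)
     \<le> ennreal (sqrt (2 * pi) / B * (LBINT s. (cmod (h s))\<^sup>2))"
proof -
  define K where "K x y = exp (- (B * (x - y))\<^sup>2 / 2)" for x y
  have [measurable]: "case_prod K \<in> borel_measurable (lborel \<Otimes>\<^sub>M lborel)" "\<And>x. K x \<in> borel_measurable lborel"
    unfolding K_def by measurable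
  have K0: "K x y \<ge> 0" for x y by (simp add: K_def)
  have K_sym: "K x y = K y x" for x y
    by (simp add: K_def power_mult_distrib power2_commute[of x y])
  have K1: "(\<integral>\<^sup>+ y. ennreal (K x y) \<partial>lborel) = ennreal (sqrt (2 * pi) / B)" for x
    unfolding K_def by (rule nn_integral_gaussian[OF B])
  have K2: "(\<integral>\<^sup>+ y. ennreal (c * K x y) \<partial>lborel) = ennreal c * ennreal (sqrt (2 * pi) / B)" if "c \<ge> 0" for c x
    using that by (simp add: ennreal_mult' nn_integral_cmult K1)
  define I where "I = (\<integral>\<^sup>+ x. \<integral>\<^sup>+ y. ennreal ((cmod (h x))\<^sup>2 / 2 * K x y) \<partial>lborel \<partial>lborel)"
  have I: "I = ennreal (sqrt (2 * pi) / B * (LBINT s. (cmod (h s))\<^sup>2) / 2)"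
  proof -
    have "I = (\<integral>\<^sup>+ x. ennreal ((cmod (h x))\<^sup>2 / 2) * ennreal (sqrt (2 * pi) / B) \<partial>lborel)"
      unfolding I_def by (intro nn_integral_cong K2) simp
    also have "\<dots> = (\<integral>\<^sup>+ x. ennreal (sqrt (2 * pi) / B / 2 * (cmod (h x))\<^sup>2) \<partial>lborel)"
      using B by (simp add: ennreal_mult'[symmetric] mult.commute)
    also have "\<dots> = ennreal (LBINT x. sqrt (2 * pi) / B / 2 * (cmod (h x))\<^sup>2)"
      using B h2 by (intro nn_integral_eq_integral) auto
    finally show ?thesis by simp
  qed
  have sym: "(\<integral>\<^sup>+ x. \<integral>\<^sup>+ y. ennreal ((cmod (h y))\<^sup>2 / 2 * K x y) \<partial>lborel \<partial>lborel) = I"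
  proof -
    have "(\<integral>\<^sup>+ x. \<integral>\<^sup>+ y. ennreal ((cmod (h y))\<^sup>2 / 2 * K x y) \<partial>lborel \<partial>lborel)
        = (\<integral>\<^sup>+ y. \<integral>\<^sup>+ x. ennreal ((cmod (h y))\<^sup>2 / 2 * K x y) \<partial>lborel \<partial>lborel)"
      by (rule lborel_pair.Fubini'[symmetric]) measurable
    also have "\<dots> = I"
      unfolding I_def by (intro nn_integral_cong) (subst K_sym, rule refl)
    finally show ?thesis .
  qed
  have "(\<integral>\<^sup>+ x. \<integral>\<^sup>+ y. ennreal (cmod (h x) * cmod (h y) * K x y) \<partial>lborel \<partial>lborel)
    \<le> (\<integral>\<^sup>+ x. \<integral>\<^sup>+ y. ennreal ((cmod (h x))\<^sup>2 / 2 * K x y) + ennreal ((cmod (h y))\<^sup>2 / 2 * K x y) \<partial>lborel \<partial>lborel)"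
  proof (intro nn_integral_mono)
    fix x y :: real
    have "cmod (h x) * cmod (h y) \<le> (cmod (h x))\<^sup>2 / 2 + (cmod (h y))\<^sup>2 / 2"
      using sum_squares_bound[of "cmod (h x)" "cmod (h y)"] by simp
    from mult_right_mono[OF this K0[of x y]]
    have "ennreal (cmod (h x) * cmod (h y) * K x y)
       \<le> ennreal ((cmod (h x))\<^sup>2 / 2 * K x y + (cmod (h y))\<^sup>2 / 2 * K x y)"
      by (intro ennreal_leI) (simp only: distrib_right)
    also have "\<dots> = ennreal ((cmod (h x))\<^sup>2 / 2 * K x y) + ennreal ((cmod (h y))\<^sup>2 / 2 * K x y)"
      by (rule ennreal_plus) (simp_all add: K0)
    finally show "ennreal (cmod (h x) * cmod (h y) * K x y)
       \<le> ennreal ((cmod (h x))\<^sup>2 / 2 * K x y) + ennreal ((cmod (h y))\<^sup>2 / 2 * K x y)" .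
  qed
  also have "\<dots> = (\<integral>\<^sup>+ x. (\<integral>\<^sup>+ y. ennreal ((cmod (h x))\<^sup>2 / 2 * K x y) \<partial>lborel) + 
        (\<integral>\<^sup>+ y. ennreal ((cmod (h y))\<^sup>2 / 2 * K x y) \<partial>lborel) \<partial>lborel)"
    by (intro nn_integral_cong nn_integral_add) measurable
  also have "\<dots> = (\<integral>\<^sup>+ x. \<integral>\<^sup>+ y. ennreal ((cmod (h x))\<^sup>2 / 2 * K x y) \<partial>lborel \<partial>lborel) +
        (\<integral>\<^sup>+ x. \<integral>\<^sup>+ y. ennreal ((cmod (h y))\<^sup>2 / 2 * K x y) \<partial>lborel \<partial>lborel)"
    by (rule nn_integral_add) measurable
  also have "\<dots> = I + I"
    by (simp only: sym flip: I_def)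
  also have "\<dots> = ennreal (sqrt (2 * pi) / B * (LBINT s. (cmod (h s))\<^sup>2))"
    unfolding I using B by (subst ennreal_plus[symmetric]) (auto intro!: Bochner_Integration.integral_nonneg)
  finally show ?thesis unfolding K_def .
qed

lemma norm_fourier_le:
  fixes h :: "real \<Rightarrow> complex"
  shows "cmod (LBINT s. iexp (u * s) * h s) \<le> (LBINT s. cmod (h s))"
  using integral_norm_bound[of lborel "\<lambda>s. iexp (u * s) * h s"] by (simp add: norm_mult)

lemma continuous_on_fourier:
  fixes h :: "real \<Rightarrow> complex"
  assumes h: "integrable lborel h"
  shows "continuous_on A (\<lambda>u. LBINT s. iexp (u * s) * h s)"
  unfolding continuous_on_sequentially
proof (intro allI impI ballI, elim conjE)
  fix X :: "nat \<Rightarrow> real" and u assume "X \<longlonglongrightarrow> u"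
  show "((\<lambda>u. LBINT s. iexp (u * s) * h s) \<circ> X) \<longlonglongrightarrow> (LBINT s. iexp (u * s) * h s)"
    unfolding o_def using h \<open>X \<longlonglongrightarrow> u\<close>
    by (intro integral_dominated_convergence[where w = "\<lambda>s. cmod (h s)"])
       (auto simp: norm_mult intro!: tendsto_intros AE_I2)
qed

text \<open>Expanding the square and exchanging integrals, the mean over the Gaussian variable \<open>z\<close> turns
  \<open>exp (\<i> B z (x - y))\<close> into the characteristic function of the normal distribution at
  \<open>B (x - y)\<close>, which leaves the quadratic form of \<open>nn_integral_gaussian_form_le\<close>.\<close>
lemma gaussian_mean_fourier_sq_le:
  fixes h :: "real \<Rightarrow> complex"
  assumes h: "integrable lborel h" and h2: "integrable lborel (\<lambda>s. (cmod (h s))\<^sup>2)" and B: "B > 0"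
  shows "(LINT z|std_normal_distribution. (cmod (LBINT s. iexp (B * z * s) * h s))\<^sup>2)
     \<le> sqrt (2 * pi) / B * (LBINT s. (cmod (h s))\<^sup>2)"
proof -
  define F where "F u = (LBINT s. iexp (u * s) * h s)" for u
  define M where "M = std_normal_distribution"
  define N where "N = (LBINT s. cmod (h s))"
  interpret M: real_distribution M unfolding M_def by (rule real_dist_normal_dist)
  interpret P: pair_sigma_finite M lborel ..
  have [measurable]: "h \<in> borel_measurable borel" using h by auto
  have [measurable_cong]: "sets M = sets borel" by simp
  have [measurable]: "cnj \<in> borel_measurable borel"
    by (intro borel_measurable_continuous_onI continuous_intros)
  have F_le: "cmod (F u) \<le> N" for u unfolding F_def N_def by (rule norm_fourier_le)
  have [measurable]: "F \<in> borel_measurable borel"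
    unfolding F_def by (intro borel_measurable_continuous_onI continuous_on_fourier h)
  have cnjF: "cnj (F u) = (LBINT s. iexp (- (u * s)) * cnj (h s))" for u
    unfolding F_def Bochner_Integration.integral_cnj[symmetric]
    by (intro Bochner_Integration.integral_cong refl) (simp add: exp_cnj)
  define Q where "Q x = (LBINT y. cnj (h y) * exp (- (B * (x - y))\<^sup>2 / 2))" for x
  have Q: "(LINT z|M. iexp (B * z * x) * cnj (F (B * z))) = Q x" for x
  proof -
    have "(LINT z|M. iexp (B * z * x) * cnj (F (B * z))) = 
       (LINT z|M. (LBINT y. iexp (B * (x - y) * z) * cnj (h y)))"
      unfolding cnjF
      by (subst integral_mult_right_zero[symmetric], intro Bochner_Integration.integral_cong refl)
         (simp add: exp_add[symmetric] mult.assoc[symmetric], simp add: algebra_simps)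
    also have "\<dots> = (LBINT y. (LINT z|M. iexp (B * (x - y) * z) * cnj (h y)))"
      by (rule P.Fubini_integral[symmetric], rule P.integrable_pair_dominated[where g = "\<lambda>_. 1" and h = h])
         (auto simp: h norm_mult)
    also have "\<dots> = (LBINT y. cnj (h y) * char M (B * (x - y)))"
      unfolding char_def
      by (intro Bochner_Integration.integral_cong refl) (subst integral_mult_left_zero, rule mult.commute)
    also have "\<dots> = Q x"
      unfolding Q_def M_def char_std_normal_distribution by simp
    finally show ?thesis .
  qed
  let ?f = "\<lambda>z x. iexp (B * z * x) * cnj (F (B * z)) * h x"
  have int: "integrable (M \<Otimes>\<^sub>M lborel) (\<lambda>(z, x). ?f z x)"
    by (rule P.integrable_pair_dominated[where g = "\<lambda>_. N" and h = h])
       (auto simp: h norm_mult intro!: mult_right_mono F_le)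
  have "complex_of_real (LINT z|M. (cmod (F (B * z)))\<^sup>2) = (LINT z|M. F (B * z) * cnj (F (B * z)))"
    by (subst integral_complex_of_real[symmetric]) (simp only: complex_norm_square)
  also have "\<dots> = (LINT z|M. (LBINT x. ?f z x))"
    by (intro Bochner_Integration.integral_cong refl, subst (1) F_def, subst integral_mult_left_zero[symmetric])
       (simp add: mult_ac)
  also have "\<dots> = (LBINT x. (LINT z|M. ?f z x))"
    by (rule P.Fubini_integral[symmetric, OF int])
  also have "\<dots> = (LBINT x. Q x * h x)"
    unfolding Q[symmetric] by (subst integral_mult_left_zero) simp
  finally have eq: "complex_of_real (LINT z|M. (cmod (F (B * z)))\<^sup>2) = (LBINT x. Q x * h x)" .
  have intQ: "integrable lborel (\<lambda>x. Q x * h x)"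
    using P.integrable_snd[OF int] unfolding Q[symmetric] by (simp add: integral_mult_left_zero)
  have Q_le: "ennreal (cmod (Q x)) \<le> (\<integral>\<^sup>+ y. ennreal (cmod (h y) * exp (- (B * (x - y))\<^sup>2 / 2)) \<partial>lborel)" for x
  proof -
    have "integrable lborel (\<lambda>y. cnj (h y) * exp (- (B * (x - y))\<^sup>2 / 2))"
      by (rule Bochner_Integration.integrable_bound[OF h]) (auto simp: norm_mult mult_left_le)
    from integral_norm_bound_ennreal[OF this] show ?thesis unfolding Q_def by (simp add: norm_mult)
  qed
  have "0 \<le> (LINT z|M. (cmod (F (B * z)))\<^sup>2)" by (intro Bochner_Integration.integral_nonneg) auto
  then have "ennreal (LINT z|M. (cmod (F (B * z)))\<^sup>2) = ennreal (cmod (LBINT x. Q x * h x))"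
    unfolding eq[symmetric] by simp
  also have "\<dots> \<le> (\<integral>\<^sup>+ x. ennreal (cmod (Q x * h x)) \<partial>lborel)"
    by (rule integral_norm_bound_ennreal[OF intQ])
  also have "\<dots> \<le> (\<integral>\<^sup>+ x. \<integral>\<^sup>+ y. ennreal (cmod (h x) * cmod (h y) * exp (- (B * (x - y))\<^sup>2 / 2)) \<partial>lborel \<partial>lborel)"
  proof (rule nn_integral_mono)
    fix x
    have "ennreal (cmod (Q x * h x)) = ennreal (cmod (h x)) * ennreal (cmod (Q x))"
      by (simp add: norm_mult ennreal_mult' mult.commute)
    also have "\<dots> \<le> ennreal (cmod (h x)) * (\<integral>\<^sup>+ y. ennreal (cmod (h y) * exp (- (B * (x - y))\<^sup>2 / 2)) \<partial>lborel)"
      by (intro mult_left_mono Q_le) auto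
    also have "\<dots> = (\<integral>\<^sup>+ y. ennreal (cmod (h x) * cmod (h y) * exp (- (B * (x - y))\<^sup>2 / 2)) \<partial>lborel)"
      by (subst nn_integral_cmult[symmetric]) (auto simp: ennreal_mult'[symmetric] mult.assoc)
    finally show "ennreal (cmod (Q x * h x)) \<le> \<dots>" .
  qed
  also have "\<dots> \<le> ennreal (sqrt (2 * pi) / B * (LBINT s. (cmod (h s))\<^sup>2))"
    by (rule nn_integral_gaussian_form_le) (use B h2 in auto)
  finally show ?thesis
    unfolding F_def[symmetric] M_def[symmetric] using B by (subst (asm) ennreal_le_iff) (auto intro!: Bochner_Integration.integral_nonneg)
qed

text \<open>The upper half of Plancherel's theorem, up to the factor \<open>exp (1 / 2)\<close> in the constant. On
  \<open>[-B, B]\<close> the density of the normal distribution with standard deviation \<open>B\<close> is at least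
  \<open>exp (- 1 / 2)\<close> times its maximum, so the integral there is controlled by the Gaussian mean; the
  bound does not depend on \<open>B\<close>.\<close>
lemma fourier_L2_bound:
  fixes h :: "real \<Rightarrow> complex"
  assumes h: "integrable lborel h" and h2: "integrable lborel (\<lambda>s. (cmod (h s))\<^sup>2)" and B: "B > 0"
  shows "integral {-B..B} (\<lambda>u. (cmod (LBINT s. iexp (u * s) * h s))\<^sup>2)
     \<le> 2 * pi * exp (1 / 2) * (LBINT s. (cmod (h s))\<^sup>2)"
proof -
  define F where "F u = (cmod (LBINT s. iexp (u * s) * h s))\<^sup>2" for u
  have contF: "continuous_on A F" for A
    unfolding F_def by (intro continuous_intros continuous_on_fourier h)
  have [measurable]: "F \<in> borel_measurable borel"
    by (intro borel_measurable_continuous_onI contF)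
  have F0: "F u \<ge> 0" for u by (simp add: F_def)
  define c where "c = exp (- (1 / 2)) / sqrt (2 * pi)"
  have intB: "set_integrable lborel {-B..B} F"
    by (intro borel_integrable_atLeastAtMost' contF)
  have scale: "(LBINT z. indicator {-1..1} z * F (B * z)) = integral {-B..B} F / B"
  proof -
    have "integral {-B..B} F = (LBINT u. indicator {-B..B} u * F u)"
      using set_borel_integral_eq_integral(2)[OF intB] by (simp add: set_lebesgue_integral_def)
    also have "\<dots> = B * (LBINT z. indicator {-B..B} (B * z) * F (B * z))"
      using B lborel_integral_real_affine[of B "\<lambda>u. indicator {-B..B} u * F u" 0] by simp
    also have "(\<lambda>z. indicator {-B..B} (B * z) :: real) = indicator {-1..1}"
    proof
      fix z
      have "B * z \<in> {-B..B} \<longleftrightarrow> z \<in> {-1..1}"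
        using mult_le_cancel_left_pos[OF B, of "-1" z] mult_le_cancel_left_pos[OF B, of z 1] by simp
      then show "indicator {-B..B} (B * z) = (indicator {-1..1} z :: real)"
        by (simp add: indicator_def)
    qed
    finally show ?thesis using B by simp
  qed
  have F_bound: "F u \<le> (LBINT s. cmod (h s))\<^sup>2" for u
    unfolding F_def by (intro power_mono norm_fourier_le) auto
  have "c * (integral {-B..B} F / B) = (LBINT z. c * (indicator {-1..1} z * F (B * z)))"
    by (simp add: scale)
  also have "\<dots> \<le> (LBINT z. std_normal_density z * F (B * z))"
  proof (rule integral_mono')
    show "integrable lborel (\<lambda>z. std_normal_density z * F (B * z))"
      by (rule Bochner_Integration.integrable_bound[where f = "\<lambda>z. std_normal_density z * (LBINT s. cmod (h s))\<^sup>2"])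
         (auto simp: F0 abs_mult intro!: mult_left_mono F_bound)
    show "c * (indicator {-1..1} z * F (B * z)) \<le> std_normal_density z * F (B * z)" for z
    proof (cases "z \<in> {-1..1}")
      case True
      then have "\<bar>z\<bar> \<le> 1" by auto
      then have "z\<^sup>2 \<le> 1" by (simp add: abs_square_le_1)
      then have "c \<le> std_normal_density z"
        unfolding c_def std_normal_density_def by (auto simp: field_simps intro!: mult_right_mono)
      with True F0[of "B * z"] show ?thesis by (simp add: mult_right_mono)
    qed (simp add: F0)
    show "0 \<le> std_normal_density z * F (B * z)" for z by (simp add: F0)
  qed
  also have "\<dots> = (LINT z|std_normal_distribution. F (B * z))"
    by (subst integral_real_density) auto
  also have "\<dots> \<le> sqrt (2 * pi) / B * (LBINT s. (cmod (h s))\<^sup>2)"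
    unfolding F_def using gaussian_mean_fourier_sq_le[OF assms] by simp
  finally have "c * integral {-B..B} F \<le> sqrt (2 * pi) * (LBINT s. (cmod (h s))\<^sup>2)"
    using B by (simp add: field_simps)
  moreover have "c > 0" by (simp add: c_def)
  ultimately have "integral {-B..B} F \<le> sqrt (2 * pi) / c * (LBINT s. (cmod (h s))\<^sup>2)"
    by (simp add: field_simps)
  also have "sqrt (2 * pi) / c = 2 * pi * exp (1 / 2)"
    by (simp add: c_def exp_minus field_simps)
  finally show ?thesis unfolding F_def .
qed

section \<open>Hoelder continuity of the integral with the transformed derivative\<close>

lemma min_le_powr:
  assumes "y \<ge> 0" "0 < a" "a \<le> (1 :: real)"
  shows "min 2 y \<le> 2 * y powr a"
proof (cases "y \<le> 1")
  case True
  have "y \<le> y powr a"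
    using assms True powr_mono'[of a 1 y] by (cases "y = 0") auto
  moreover have "y powr a \<ge> 0" by simp
  ultimately show ?thesis using min.cobounded2[of 2 y] by linarith
next
  case False
  then have "1 \<le> y powr a" using assms by (intro ge_one_powr_ge_zero) auto
  then show ?thesis by (simp add: min_def)
qed

lemma norm_exp_diff_le_powr:
  fixes z :: complex
  assumes z: "Re z \<le> 0" and x: "x \<ge> 0" and s: "s \<ge> 0" and a: "0 < a" "a \<le> 1"
  shows "cmod (exp (z * of_real x) - exp (z * of_real s)) \<le> 2 * (cmod z * \<bar>x - s\<bar>) powr a"
proof -
  have neg: "Re (z * of_real x) \<le> 0" "Re (z * of_real s) \<le> 0"
    using z x s by (auto intro: mult_nonpos_nonneg)
  have "cmod (exp (z * of_real x) - exp (z * of_real s)) \<le> 1 * cmod (z * of_real x - z * of_real s)"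
    by (rule field_differentiable_bound[where S = "{w. Re w \<le> 0}" and f' = exp])
       (use neg in \<open>auto intro!: derivative_eq_intros convex_halfspace_Re_le\<close>)
  also have "\<dots> = cmod z * \<bar>x - s\<bar>"
    by (simp add: norm_mult flip: right_diff_distrib of_real_diff)
  finally have 1: "cmod (exp (z * of_real x) - exp (z * of_real s)) \<le> cmod z * \<bar>x - s\<bar>" .
  have "cmod (exp (z * of_real x) - exp (z * of_real s)) \<le> cmod (exp (z * of_real x)) + cmod (exp (z * of_real s))"
    by (rule norm_triangle_ineq4)
  also have "\<dots> \<le> 1 + 1"
    using neg by (intro add_mono) (simp_all add: norm_exp_eq_Re)
  finally show ?thesis
    using 1 min_le_powr[of "cmod z * \<bar>x - s\<bar>" a] a by (auto simp: min_def split: if_splits)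
qed

text \<open>Interpolating between the trivial and the Lipschitz bound of each exponential yields the powers
  \<open>1 / 2\<close> and \<open>1 / 4\<close>, chosen so that both terms grow like \<open>\<bar>k\<bar>^(1/2)\<close>. Inside the quadrant
  \<open>exp (- \<i> k\<^sup>2 t)\<close> grows with \<open>t\<close>; factoring out its value at \<open>T\<close> reduces this to decay in
  \<open>T - t\<close>. The constant \<open>M\<close> may be taken to be 1 on the axes.\<close>
lemma norm_kernel_diff_le:
  fixes k :: complex
  assumes k: "Re k \<ge> 0" "Im k \<ge> 0" and x: "x \<ge> 0" "s \<ge> 0" and t: "t \<in> {0..T}" "\<tau> \<in> {0..T}"
    and M: "exp (2 * Re k * Im k * T) \<le> M"
  shows "cmod (exp (\<i> * k * of_real x - \<i> * omega k * of_real t) - exp (\<i> * k * of_real s - \<i> * omega k * of_real \<tau>))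
     \<le> 2 * M * cmod k powr (1/2) * (\<bar>x - s\<bar> powr (1/2) + \<bar>t - \<tau>\<bar> powr (1/4))"
proof -
  define a where "a = \<i> * k"
  define w where "w = - (\<i> * omega k)"
  have Re_a: "Re a \<le> 0" using k by (simp add: a_def)
  have Re_w: "Re w = 2 * Re k * Im k" by (simp add: w_def omega_def power2_eq_square)
  then have Re_w0: "Re w \<ge> 0" using k by simp
  have nrm: "cmod a = cmod k" "cmod w = (cmod k)\<^sup>2" 
    by (simp_all add: a_def w_def omega_def norm_mult norm_power)
  have wT: "cmod (exp (w * of_real u)) \<le> M" if "u \<in> {0..T}" for u
  proof -
    have "Re w * u \<le> Re w * T" using that Re_w0 by (intro mult_left_mono) auto
    then show ?thesis using M Re_w by (auto simp: norm_exp_eq_Re intro: order_trans[rotated])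
  qed
  have M0: "M \<ge> 0" using M exp_ge_zero order_trans by blast
  have 1: "cmod (exp (a * of_real x) - exp (a * of_real s)) \<le> 2 * (cmod k powr (1/2) * \<bar>x - s\<bar> powr (1/2))"
    using norm_exp_diff_le_powr[OF Re_a x, of "1/2"] by (simp add: nrm powr_mult)
  \<comment> \<open>The exponent \<open>- w\<close> has nonpositive real part, so the decaying case applies on the time scale \<open>T - u\<close>.\<close>
  have eqw: "exp (w * of_real u) = exp (w * of_real T) * exp (- w * of_real (T - u))" for u
    by (simp add: algebra_simps flip: exp_add)
  have 2: "cmod (exp (w * of_real t) - exp (w * of_real \<tau>)) \<le> M * (2 * (cmod k powr (1/2) * \<bar>t - \<tau>\<bar> powr (1/4)))"
  proof -
    have "cmod (exp (w * of_real t) - exp (w * of_real \<tau>)) =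
        cmod (exp (w * of_real T)) * cmod (exp (- w * of_real (T - t)) - exp (- w * of_real (T - \<tau>)))"
      unfolding eqw[of t] eqw[of \<tau>] by (simp add: norm_mult flip: right_diff_distrib)
    also have "\<dots> \<le> M * (2 * (cmod (- w) * \<bar>(T - t) - (T - \<tau>)\<bar>) powr (1/4))"
      using t Re_w0 M0 by (intro mult_mono wT norm_exp_diff_le_powr) auto
    also have "(cmod (- w) * \<bar>(T - t) - (T - \<tau>)\<bar>) powr (1/4) = cmod k powr (1/2) * \<bar>t - \<tau>\<bar> powr (1/4)"
      by (simp add: nrm powr_mult powr_powr abs_minus_commute flip: powr_numeral)
    finally show ?thesis .
  qed
  have "cmod (exp (a * of_real s)) \<le> 1"
    using Re_a x by (simp add: norm_exp_eq_Re mult_nonpos_nonneg)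
  then have 3: "cmod (exp (a * of_real s)) * cmod (exp (w * of_real t) - exp (w * of_real \<tau>))
     \<le> 1 * (M * (2 * (cmod k powr (1/2) * \<bar>t - \<tau>\<bar> powr (1/4))))"
    using 2 by (intro mult_mono) auto
  have 4: "cmod (exp (w * of_real t)) * cmod (exp (a * of_real x) - exp (a * of_real s))
     \<le> M * (2 * (cmod k powr (1/2) * \<bar>x - s\<bar> powr (1/2)))"
    using wT[OF t(1)] 1 M0 by (intro mult_mono) auto
  have "exp (\<i> * k * of_real x - \<i> * omega k * of_real t) - exp (\<i> * k * of_real s - \<i> * omega k * of_real \<tau>)
    = exp (w * of_real t) * (exp (a * of_real x) - exp (a * of_real s)) +
      exp (a * of_real s) * (exp (w * of_real t) - exp (w * of_real \<tau>))"
    unfolding a_def w_def by (simp add: exp_diff exp_minus field_simps)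
  then have "cmod (exp (\<i> * k * of_real x - \<i> * omega k * of_real t) - exp (\<i> * k * of_real s - \<i> * omega k * of_real \<tau>))
    \<le> cmod (exp (w * of_real t)) * cmod (exp (a * of_real x) - exp (a * of_real s)) +
      cmod (exp (a * of_real s)) * cmod (exp (w * of_real t) - exp (w * of_real \<tau>))"
    by (metis norm_mult norm_triangle_ineq)
  with 3 4 show ?thesis by (simp add: algebra_simps)
qed

lemma continuous_on_complex_fourier:
  fixes h :: "real \<Rightarrow> complex"
  assumes h: "integrable lborel h" and supp: "\<And>\<sigma>. \<sigma> \<notin> {0..T} \<Longrightarrow> h \<sigma> = 0"
  shows "continuous_on A (\<lambda>z. LBINT \<sigma>. exp (\<i> * z * of_real \<sigma>) * h \<sigma>)"
  unfolding continuous_on_sequentially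
proof (intro allI impI ballI, elim conjE)
  fix X :: "nat \<Rightarrow> complex" and z assume X: "X \<longlonglongrightarrow> z"
  then obtain B where B: "\<And>n. cmod (X n) \<le> B"
    using convergent_imp_Bseq[of X] by (auto simp: convergent_def Bseq_def)
  show "((\<lambda>z. LBINT \<sigma>. exp (\<i> * z * of_real \<sigma>) * h \<sigma>) \<circ> X) \<longlonglongrightarrow> (LBINT \<sigma>. exp (\<i> * z * of_real \<sigma>) * h \<sigma>)"
    unfolding o_def
  proof (intro integral_dominated_convergence[where w = "\<lambda>\<sigma>. exp (B * T) * cmod (h \<sigma>)"] AE_I2)
    fix n \<sigma>
    show "cmod (exp (\<i> * X n * of_real \<sigma>) * h \<sigma>) \<le> exp (B * T) * cmod (h \<sigma>)"
    proof (cases "\<sigma> \<in> {0..T}")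
      case True
      have "cmod (exp (\<i> * X n * of_real \<sigma>)) \<le> exp (cmod (\<i> * X n * of_real \<sigma>))"
        by (rule norm_exp)
      also have "cmod (\<i> * X n * of_real \<sigma>) \<le> B * T"
        using True B[of n] order_trans[OF norm_ge_zero B[of n]] by (auto simp: norm_mult intro!: mult_mono)
      finally show ?thesis by (simp add: norm_mult mult_right_mono)
    qed (simp add: supp)
  qed (use h X in \<open>auto intro!: tendsto_intros\<close>)
qed

lemma norm_complex_fourier_le:
  fixes h :: "real \<Rightarrow> complex"
  assumes h: "integrable lborel h" and supp: "\<And>\<sigma>. \<sigma> \<notin> {0..T} \<Longrightarrow> h \<sigma> = 0" and z: "Im z \<ge> 0"
  shows "cmod (LBINT \<sigma>. exp (\<i> * z * of_real \<sigma>) * h \<sigma>) \<le> (LBINT \<sigma>. cmod (h \<sigma>))"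
proof (rule order_trans[OF integral_norm_bound integral_mono'])
  show "cmod (exp (\<i> * z * of_real \<sigma>) * h \<sigma>) \<le> cmod (h \<sigma>)" for \<sigma>
  proof (cases "\<sigma> \<in> {0..T}")
    case True
    then have "cmod (exp (\<i> * z * of_real \<sigma>)) \<le> 1" using z by (simp add: norm_exp_eq_Re)
    then show ?thesis by (simp add: norm_mult mult_left_le_one_le)
  qed (simp add: supp)
qed (use h in auto)

text \<open>Under \<open>u = y\<^sup>2\<close> the real half axis sees the positive and the imaginary half axis the negative
  frequencies.\<close>
lemma integral_fourier_sq_axes_le:
  fixes h :: "real \<Rightarrow> complex"
  assumes h: "integrable lborel h" and h2: "integrable lborel (\<lambda>\<sigma>. (cmod (h \<sigma>))\<^sup>2)"
    and R: "0 < R" "R < r"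
  defines "\<Phi> \<equiv> (\<lambda>u. (cmod (LBINT \<sigma>. iexp (u * \<sigma>) * h \<sigma>))\<^sup>2)"
  shows "integral {R..r} (\<lambda>y. (\<Phi> (y\<^sup>2) + \<Phi> (- (y\<^sup>2))) * y) \<le> 2 * pi * exp (1 / 2) * (LBINT \<sigma>. (cmod (h \<sigma>))\<^sup>2)"
proof -
  define C where "C = 2 * pi * exp (1 / 2) * (LBINT \<sigma>. (cmod (h \<sigma>))\<^sup>2)"
  have cont: "continuous_on A \<Phi>" for A
    unfolding \<Phi>_def by (intro continuous_intros continuous_on_fourier h)
  have cont2: "continuous_on A (\<lambda>u. \<Phi> (- u))" for A
    by (intro continuous_on_compose2[OF cont[of UNIV]] continuous_intros) auto
  have "r > 0" using R by simp
  then have full: "integral {-(r\<^sup>2)..r\<^sup>2} \<Phi> \<le> C"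
    unfolding \<Phi>_def C_def by (intro fourier_L2_bound h h2) simp
  have sub: "((\<lambda>y. 2 * y * (\<Phi> (y\<^sup>2) + \<Phi> (- (y\<^sup>2)))) has_integral
      integral {R\<^sup>2..r\<^sup>2} (\<lambda>u. \<Phi> u + \<Phi> (- u))) {R..r}"
    unfolding real_scaleR_def[symmetric]
  proof (rule has_integral_substitution[of R r "\<lambda>y. y\<^sup>2" "R\<^sup>2" "r\<^sup>2" "\<lambda>u. \<Phi> u + \<Phi> (- u)" "\<lambda>y. 2 *\<^sub>R y"])
    show "(\<lambda>y. y\<^sup>2) ` {R..r} \<subseteq> {R\<^sup>2..r\<^sup>2}" "R \<le> r" "R\<^sup>2 \<le> r\<^sup>2"
      using R by (auto intro!: power_mono)
    show "continuous_on {R\<^sup>2..r\<^sup>2} (\<lambda>u. \<Phi> u + \<Phi> (- u))"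
      by (intro continuous_on_add cont cont2)
    show "((\<lambda>y. y\<^sup>2) has_real_derivative 2 *\<^sub>R y) (at y within {R..r})" for y
      by (auto intro!: derivative_eq_intros)
  qed
  have "integral {R\<^sup>2..r\<^sup>2} (\<lambda>u. \<Phi> u + \<Phi> (- u)) \<le> integral {R\<^sup>2..r\<^sup>2} \<Phi> + integral {R\<^sup>2..r\<^sup>2} (\<lambda>u. \<Phi> (- u))"
    by (subst Henstock_Kurzweil_Integration.integral_add) (auto intro!: integrable_continuous_interval cont cont2)
  also have "integral {R\<^sup>2..r\<^sup>2} (\<lambda>u. \<Phi> (- u)) \<le> C"
  proof -
    have "integral {R\<^sup>2..r\<^sup>2} (\<lambda>u. \<Phi> (- u)) = integral {-(r\<^sup>2)..-(R\<^sup>2)} \<Phi>"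
      using Henstock_Kurzweil_Integration.integral_reflect_real[of "- (R\<^sup>2)" "- (r\<^sup>2)" \<Phi>] by simp
    also have "\<dots> \<le> integral {-(r\<^sup>2)..r\<^sup>2} \<Phi>"
      using R by (intro integral_subset_le integrable_continuous_interval cont) 
        (auto simp: \<Phi>_def intro: order_trans[of _ 0])
    finally show ?thesis using full by simp
  qed
  also have "integral {R\<^sup>2..r\<^sup>2} \<Phi> \<le> C"
  proof -
    have "integral {R\<^sup>2..r\<^sup>2} \<Phi> \<le> integral {-(r\<^sup>2)..r\<^sup>2} \<Phi>"
      using R by (intro integral_subset_le integrable_continuous_interval cont)
        (auto simp: \<Phi>_def intro: order_trans[of _ 0])
    then show ?thesis using full by simp
  qed
  finally have "integral {R..r} (\<lambda>y. 2 * y * (\<Phi> (y\<^sup>2) + \<Phi> (- (y\<^sup>2)))) \<le> 2 * C"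
    unfolding integral_unique[OF sub] by simp
  moreover have "integral {R..r} (\<lambda>y. 2 * y * (\<Phi> (y\<^sup>2) + \<Phi> (- (y\<^sup>2)))) = 
     2 * integral {R..r} (\<lambda>y. (\<Phi> (y\<^sup>2) + \<Phi> (- (y\<^sup>2))) * y)"
    by (subst Henstock_Kurzweil_Integration.integral_mult_right[symmetric]) (simp add: mult_ac)
  ultimately show ?thesis by (simp add: C_def)
qed

text \<open>With \<open>a = \<bar>G k\<bar>\<close> on a half axis, the left side is what the kernel estimate leaves, and both
  terms on the right have bounded integrals over \<open>{R..}\<close>; this is Cauchy-Schwarz without square roots.\<close>
lemma weighted_am_gm:
  fixes a b y :: real
  assumes "a\<^sup>2 \<le> b" "y > 0"
  shows "2 * y powr (1/2) * a / y \<le> b * y + 1 / y\<^sup>2"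
proof -
  have "2 * (a * sqrt y) * (1 / y) \<le> (a * sqrt y)\<^sup>2 + (1 / y)\<^sup>2"
    by (rule sum_squares_bound)
  also have "(a * sqrt y)\<^sup>2 + (1 / y)\<^sup>2 \<le> b * y + 1 / y\<^sup>2"
    using assms by (simp add: power_mult_distrib power_divide)
  finally show ?thesis using assms by (simp add: powr_half_sqrt mult_ac)
qed

text \<open>The Hoelder estimate. The function \<open>S\<close> in the proof dominates the integrand on both half axes, up to
  the factor \<open>\<epsilon>\<close> for the difference of two integrands and up to a constant for a single
  one, and its integral is bounded by \<open>C\<close>.\<close>
lemma D1_integral_G_estimates:
  fixes h :: "real \<Rightarrow> complex" and R T :: real
  assumes R: "R > 0"
    and h: "integrable lborel h" and h2: "integrable lborel (\<lambda>\<sigma>. (cmod (h \<sigma>))\<^sup>2)"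
    and supp: "\<And>\<sigma>. \<sigma> \<notin> {0..T} \<Longrightarrow> h \<sigma> = 0"
  defines "G \<equiv> \<lambda>k. LBINT \<sigma>. exp (\<i> * omega k * of_real \<sigma>) * h \<sigma>"
  defines "J \<equiv> \<lambda>x t k. exp (\<i> * k * of_real x - \<i> * omega k * of_real t) * G k * (1 / (\<i> * k))"
  shows "s \<ge> 0 \<Longrightarrow> D1_convergent R (J s \<tau>)"
    and "\<lbrakk>x \<ge> 0; s \<ge> 0; t \<in> {0..T}; \<tau> \<in> {0..T}\<rbrakk> \<Longrightarrow>
      cmod (D1_integral R (J x t) - D1_integral R (J s \<tau>)) \<le>
        (pi * exp (2 * R\<^sup>2 * T) * R powr (1/2) * (LBINT \<sigma>. cmod (h \<sigma>)) +
         2 * (2 * pi * exp (1 / 2) * (LBINT \<sigma>. (cmod (h \<sigma>))\<^sup>2) + 1 / R)) *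
        (\<bar>x - s\<bar> powr (1/2) + \<bar>t - \<tau>\<bar> powr (1/4))"
proof -
  define \<Phi> where "\<Phi> u = (cmod (LBINT \<sigma>. iexp (u * \<sigma>) * h \<sigma>))\<^sup>2" for u
  define S where "S y = (\<Phi> (y\<^sup>2) + \<Phi> (- (y\<^sup>2))) * y + 1 / y\<^sup>2" for y
  define C where "C = 2 * pi * exp (1 / 2) * (LBINT \<sigma>. (cmod (h \<sigma>))\<^sup>2) + 1 / R"
  have cont\<Phi>: "continuous_on A \<Phi>" for A
    unfolding \<Phi>_def by (intro continuous_intros continuous_on_fourier h)
  have contS1: "continuous_on A (\<lambda>y. (\<Phi> (y\<^sup>2) + \<Phi> (- (y\<^sup>2))) * y)" for A
    by (intro continuous_intros continuous_on_compose2[OF cont\<Phi>[of UNIV]]) auto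
  have contS2: "continuous_on {R..r} (\<lambda>y. 1 / y\<^sup>2)" for r
    using R by (auto intro!: continuous_intros)
  have contS: "continuous_on {R..r} S" for r
    unfolding S_def by (intro continuous_on_add contS1 contS2)
  have S_le: "integral {R..r} S \<le> C" if "R < r" for r
  proof -
    have "integral {R..r} S = integral {R..r} (\<lambda>y. (\<Phi> (y\<^sup>2) + \<Phi> (- (y\<^sup>2))) * y) + integral {R..r} (\<lambda>y. 1 / y\<^sup>2)"
      unfolding S_def
      by (intro Henstock_Kurzweil_Integration.integral_add integrable_continuous_interval contS1 contS2)
    also have "\<dots> \<le> C"
      unfolding C_def \<Phi>_def
      by (intro add_mono integral_fourier_sq_axes_le h h2 R that integral_inverse_square_le)
    finally show ?thesis .
  qed
  have contG: "continuous_on A G" for A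
    unfolding G_def omega_def
    by (intro continuous_on_compose2[OF continuous_on_complex_fourier[where A = UNIV, OF h supp]] continuous_intros) auto
  have contJ: "continuous_on (- {0}) (J x t)" for x t
    unfolding J_def omega_def by (intro continuous_intros contG) auto
  have Gax: "(cmod (G (of_real y)))\<^sup>2 \<le> \<Phi> (y\<^sup>2) + \<Phi> (- (y\<^sup>2))"
            "(cmod (G (\<i> * of_real y)))\<^sup>2 \<le> \<Phi> (y\<^sup>2) + \<Phi> (- (y\<^sup>2))" for y
    unfolding G_def \<Phi>_def omega_def by (simp_all add: power_mult_distrib mult.assoc)
  have key: "2 * y powr (1/2) * cmod (G (of_real y)) / y \<le> S y"
            "2 * y powr (1/2) * cmod (G (\<i> * of_real y)) / y \<le> S y" if "y > 0" for y
    unfolding S_def by (intro weighted_am_gm Gax that)+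
  have key': "cmod (G (of_real y)) / y \<le> S y / (2 * R powr (1/2))"
             "cmod (G (\<i> * of_real y)) / y \<le> S y / (2 * R powr (1/2))" if "y \<ge> R" for y
  proof -
    have y: "y > 0" using that R by simp
    have p: "R powr (1/2) > 0" "R powr (1/2) \<le> y powr (1/2)" using R that by (auto intro: powr_mono2)
    have *: "a / y \<le> S y / (2 * R powr (1/2))" if "2 * y powr (1/2) * a / y \<le> S y" "a \<ge> 0" for a
    proof -
      have "2 * R powr (1/2) * (a / y) \<le> 2 * y powr (1/2) * (a / y)"
        using p that y by (intro mult_right_mono) auto
      with that(1) have "(a / y) * (2 * R powr (1/2)) \<le> S y" by (simp add: mult_ac)
      then show ?thesis using p(1) by (subst pos_le_divide_eq) auto
    qed
    show "cmod (G (of_real y)) / y \<le> S y / (2 * R powr (1/2))"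
      "cmod (G (\<i> * of_real y)) / y \<le> S y / (2 * R powr (1/2))"
      by (rule *; use key[OF y] in simp)+
  qed
  show conv: "D1_convergent R (J s \<tau>)" if s: "s \<ge> 0" for s \<tau>
  proof -
    let ?c = "1 / (2 * R powr (1/2))"
    have W: "continuous_on {R..r} (\<lambda>y. ?c * S y)" for r by (intro continuous_intros contS)
    have WC: "integral {R..r} (\<lambda>y. ?c * S y) \<le> ?c * C" if "R < r" for r
      unfolding Henstock_Kurzweil_Integration.integral_mult_right
      by (intro mult_left_mono S_le that) simp
    have 1: "cmod (J s \<tau> (of_real y)) \<le> ?c * S y" if "y \<ge> R" for y
    proof -
      have "cmod (J s \<tau> (of_real y)) = cmod (G (of_real y)) / y"
        using that R by (simp add: J_def omega_def norm_mult norm_divide power2_eq_square)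
      then show ?thesis using key'(1)[OF that] by simp
    qed
    have 2: "cmod (J s \<tau> (\<i> * of_real y)) \<le> ?c * S y" if "y \<ge> R" for y
    proof -
      have "cmod (J s \<tau> (\<i> * of_real y)) = exp (- (y * s)) * (cmod (G (\<i> * of_real y)) / y)"
        using that R by (simp add: J_def omega_def norm_mult norm_divide power_mult_distrib power2_eq_square)
      also have "\<dots> \<le> 1 * (cmod (G (\<i> * of_real y)) / y)"
        using that R s by (intro mult_right_mono) auto
      finally show ?thesis using key'(2)[OF that] by simp
    qed
    obtain L1 where L1: "((\<lambda>r. integral {R..r} (\<lambda>y. J s \<tau> (of_real y))) \<longlongrightarrow> L1) at_top"
      using improper_integral_dominated[OF continuous_on_axes(1)[OF contJ R] W 1 WC] by blast
    obtain L2 where L2: "((\<lambda>r. integral {R..r} (\<lambda>y. J s \<tau> (\<i> * of_real y))) \<longlongrightarrow> L2) at_top"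
      using improper_integral_dominated[OF continuous_on_axes(2)[OF contJ R] W 2 WC] by blast
    show ?thesis by (rule D1_convergentI[OF R contJ L1 L2])
  qed
  assume x: "x \<ge> 0" and s: "s \<ge> 0" and t: "t \<in> {0..T}" and \<tau>: "\<tau> \<in> {0..T}"
  define N where "N = (LBINT \<sigma>. cmod (h \<sigma>))"
  define M where "M = exp (2 * R\<^sup>2 * T)"
  define \<epsilon> where "\<epsilon> = \<bar>x - s\<bar> powr (1/2) + \<bar>t - \<tau>\<bar> powr (1/4)"
  have pos: "\<epsilon> \<ge> 0" "M \<ge> 0" "N \<ge> 0" "T \<ge> 0" using t by (auto simp: \<epsilon>_def M_def N_def)
  define D where "D k = J x t k - J s \<tau> k" for k
  have D_le: "cmod (D k) \<le> 2 * M' * cmod k powr (1/2) * \<epsilon> * cmod (G k) / cmod k"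
    if "Re k \<ge> 0" "Im k \<ge> 0" "exp (2 * Re k * Im k * T) \<le> M'" for k M'
  proof -
    have "D k = (exp (\<i> * k * of_real x - \<i> * omega k * of_real t) -
        exp (\<i> * k * of_real s - \<i> * omega k * of_real \<tau>)) * G k * (1 / (\<i> * k))"
      by (simp add: D_def J_def left_diff_distrib diff_divide_distrib)
    then have "cmod (D k) = cmod (exp (\<i> * k * of_real x - \<i> * omega k * of_real t) -
        exp (\<i> * k * of_real s - \<i> * omega k * of_real \<tau>)) * (cmod (G k) / cmod k)"
      by (simp add: norm_mult norm_divide)
    also have "\<dots> \<le> (2 * M' * cmod k powr (1/2) * \<epsilon>) * (cmod (G k) / cmod k)"
      unfolding \<epsilon>_def using that x s t \<tau> by (intro mult_right_mono norm_kernel_diff_le) auto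
    finally show ?thesis by simp
  qed
  have contD: "continuous_on (- {0}) D" unfolding D_def by (intro continuous_on_diff contJ)
  have D_axes: "cmod (D (of_real y)) \<le> \<epsilon> * S y" "cmod (D (\<i> * of_real y)) \<le> \<epsilon> * S y" if "y \<ge> R" for y
  proof -
    have y: "y > 0" using that R by simp
    show "cmod (D (of_real y)) \<le> \<epsilon> * S y"
      using D_le[of "of_real y" 1] mult_left_mono[OF key(1)[OF y] pos(1)] y by (simp add: mult_ac)
    show "cmod (D (\<i> * of_real y)) \<le> \<epsilon> * S y"
      using D_le[of "\<i> * of_real y" 1] mult_left_mono[OF key(2)[OF y] pos(1)] y by (simp add: mult_ac norm_mult)
  qed
  define A where "A = 2 * M * R powr (1/2) * \<epsilon> * N / R"
  have D_arc: "cmod (D k) \<le> A" if k: "cmod k = R" "Re k \<ge> 0" "Im k \<ge> 0" for k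
  proof -
    have "Re k \<le> R" "Im k \<le> R" using k complex_Re_le_cmod[of k] abs_Im_le_cmod[of k] by auto
    then have "Re k * Im k \<le> R\<^sup>2" using k R by (auto simp: power2_eq_square intro!: mult_mono)
    from mult_right_mono[OF this pos(4)] have "2 * Re k * Im k * T \<le> 2 * R\<^sup>2 * T" by simp
    then have "exp (2 * Re k * Im k * T) \<le> M" by (simp add: M_def)
    from D_le[OF k(2,3) this] have "cmod (D k) \<le> 2 * M * R powr (1/2) * \<epsilon> * cmod (G k) / R"
      by (simp add: k(1))
    also have "Im (omega k) \<ge> 0" using k by (simp add: omega_def power2_eq_square)
    then have "cmod (G k) \<le> N" unfolding G_def N_def by (intro norm_complex_fourier_le[OF h supp])
    then have "2 * M * R powr (1/2) * \<epsilon> * cmod (G k) / R \<le> A"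
      unfolding A_def using pos R by (intro divide_right_mono mult_left_mono) auto
    finally show ?thesis .
  qed
  have A0: "A \<ge> 0" unfolding A_def using pos R by simp
  have lim: "((\<lambda>r. contour_integral (bdry_D1 R r) D) \<longlongrightarrow> D1_integral R (J x t) - D1_integral R (J s \<tau>)) at_top"
    using has_D1_integral_diff[OF D1_convergent_imp_has_D1_integral[OF conv[OF x]] 
        D1_convergent_imp_has_D1_integral[OF conv[OF s]]]
    unfolding has_D1_integral_def D_def by blast
  have "\<forall>\<^sub>F r in at_top. cmod (contour_integral (bdry_D1 R r) D) \<le> A * R * (pi / 2) + 2 * (\<epsilon> * C)"
    using eventually_gt_at_top[of R]
  proof eventually_elim
    case (elim r)
    have "cmod (contour_integral (bdry_D1 R r) D) \<le> A * R * (pi / 2) + 2 * integral {R..r} (\<lambda>y. \<epsilon> * S y)"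
      by (rule norm_contour_integral_bdry_D1_le[OF R elim contD])
         (auto intro!: continuous_intros contS D_arc A0 D_axes)
    also have "integral {R..r} (\<lambda>y. \<epsilon> * S y) \<le> \<epsilon> * C"
      unfolding Henstock_Kurzweil_Integration.integral_mult_right
      by (intro mult_left_mono S_le elim pos)
    finally show ?case by simp
  qed
  from Lim_norm_ubound[OF _ lim this]
  have "cmod (D1_integral R (J x t) - D1_integral R (J s \<tau>)) \<le> A * R * (pi / 2) + 2 * (\<epsilon> * C)"
    by simp
  also have "\<dots> = (pi * M * R powr (1/2) * N + 2 * C) * \<epsilon>"
    using R by (simp add: A_def algebra_simps)
  finally show "cmod (D1_integral R (J x t) - D1_integral R (J s \<tau>)) \<le>
        (pi * exp (2 * R\<^sup>2 * T) * R powr (1/2) * (LBINT \<sigma>. cmod (h \<sigma>)) +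
         2 * (2 * pi * exp (1 / 2) * (LBINT \<sigma>. (cmod (h \<sigma>))\<^sup>2) + 1 / R)) *
        (\<bar>x - s\<bar> powr (1/2) + \<bar>t - \<tau>\<bar> powr (1/4))"
    unfolding M_def N_def C_def \<epsilon>_def .
qed

section \<open>Integration by parts for Sobolev data\<close>

lemma integral_exp_interval:
  fixes a :: complex
  assumes "a \<noteq> 0" "c \<le> d"
  shows "(LBINT s. indicator {c..d} s *\<^sub>R exp (a * of_real s)) = (exp (a * of_real d) - exp (a * of_real c)) / a"
proof -
  have "(LBINT s. indicator {c..d} s *\<^sub>R exp (a * of_real s)) = exp (a * of_real d) / a - exp (a * of_real c) / a"
  proof (rule integral_FTC_atLeastAtMost[OF assms(2)])
    fix s
    show "((\<lambda>s. exp (a * of_real s) / a) has_vector_derivative exp (a * of_real s)) (at s within {c..d})"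
      by (rule has_vector_derivative_real_field[where f = "\<lambda>z. exp (a * z) / a"])
         (use assms in \<open>auto intro!: derivative_eq_intros\<close>)
  qed (intro continuous_intros)
  then show ?thesis by (simp add: diff_divide_distrib)
qed

text \<open>The primitive \<open>P\<close> of an integrable function is differentiable only almost everywhere, so the
  formula is obtained by exchanging the two integrations over the triangle
  \<open>0 \<le> \<sigma> \<le> s \<le> t\<close> instead of by the product rule.\<close>
lemma integration_by_parts_exp:
  fixes h :: "real \<Rightarrow> complex" and a c0 :: complex and t :: real
  assumes a: "a \<noteq> 0" and t: "t \<ge> 0" and h: "integrable lborel h"
  defines "P \<equiv> \<lambda>s. LBINT \<sigma>. indicator {0..s} \<sigma> *\<^sub>R h \<sigma>"
  shows "a * (LBINT s. indicator {0..t} s *\<^sub>R (exp (a * of_real s) * (c0 + P s))) =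
     exp (a * of_real t) * (c0 + P t) - c0 - (LBINT \<sigma>. indicator {0..t} \<sigma> *\<^sub>R (exp (a * of_real \<sigma>) * h \<sigma>))"
proof -
  have [measurable]: "h \<in> borel_measurable borel" using h by auto
  define f where "f s \<sigma> = (if 0 \<le> \<sigma> \<and> \<sigma> \<le> s \<and> s \<le> t then exp (a * of_real s) * h \<sigma> else 0)" for s \<sigma>
  define E where "E s = indicator {0..t} s *\<^sub>R exp (a * of_real s)" for s
  have intE: "integrable lborel E"
    unfolding E_def by (fold set_integrable_def, intro borel_integrable_atLeastAtMost' continuous_intros)
  have intf: "integrable (lborel \<Otimes>\<^sub>M lborel) (\<lambda>(s, \<sigma>). f s \<sigma>)"
  proof (rule lborel_pair.integrable_pair_dominated[where g = "\<lambda>s. cmod (E s)" and h = h])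
    show "(\<lambda>(s, \<sigma>). f s \<sigma>) \<in> borel_measurable (lborel \<Otimes>\<^sub>M lborel)"
      unfolding f_def by measurable
    show "cmod (case (s, \<sigma>) of (s, \<sigma>) \<Rightarrow> f s \<sigma>) \<le> cmod (E s) * cmod (h \<sigma>)" for s \<sigma>
      by (auto simp: f_def E_def norm_mult)
  qed (use intE h in auto)
  have f1: "(LBINT \<sigma>. f s \<sigma>) = E s * P s" for s
  proof -
    have "(LBINT \<sigma>. f s \<sigma>) = (LBINT \<sigma>. E s * (indicator {0..s} \<sigma> *\<^sub>R h \<sigma>))"
      by (intro Bochner_Integration.integral_cong) (auto simp: f_def E_def indicator_def)
    also have "\<dots> = E s * P s"
      unfolding P_def by (rule integral_mult_right_zero)
    finally show ?thesis .
  qed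
  have f2: "(LBINT s. f s \<sigma>) = indicator {0..t} \<sigma> *\<^sub>R (h \<sigma> * ((exp (a * of_real t) - exp (a * of_real \<sigma>)) / a))" for \<sigma>
  proof (cases "\<sigma> \<in> {0..t}")
    case True
    have "(LBINT s. f s \<sigma>) = (LBINT s. h \<sigma> * (indicator {\<sigma>..t} s *\<^sub>R exp (a * of_real s)))"
      using True by (intro Bochner_Integration.integral_cong) (auto simp: f_def indicator_def)
    also have "\<dots> = h \<sigma> * (LBINT s. indicator {\<sigma>..t} s *\<^sub>R exp (a * of_real s))"
      by (rule integral_mult_right_zero)
    also have "\<dots> = h \<sigma> * ((exp (a * of_real t) - exp (a * of_real \<sigma>)) / a)"
      using integral_exp_interval[OF a, of \<sigma> t] True by simp
    finally show ?thesis using True by simp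
  next
    case False
    then have "f s \<sigma> = 0" for s by (auto simp: f_def)
    with False show ?thesis by simp
  qed
  have int1: "integrable lborel (\<lambda>\<sigma>. indicator {0..t} \<sigma> *\<^sub>R h \<sigma>)"
    by (rule Bochner_Integration.integrable_bound[OF h]) (auto simp: indicator_def)
  have int2: "integrable lborel (\<lambda>\<sigma>. indicator {0..t} \<sigma> *\<^sub>R (exp (a * of_real \<sigma>) * h \<sigma>))"
  proof (rule Bochner_Integration.integrable_bound)
    show "integrable lborel (\<lambda>\<sigma>. exp (cmod a * t) * cmod (h \<sigma>))" using h by simp
    show "AE \<sigma> in lborel. cmod (indicator {0..t} \<sigma> *\<^sub>R (exp (a * of_real \<sigma>) * h \<sigma>)) \<le> norm (exp (cmod a * t) * cmod (h \<sigma>))"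
    proof (rule AE_I2)
      fix \<sigma>
      show "cmod (indicator {0..t} \<sigma> *\<^sub>R (exp (a * of_real \<sigma>) * h \<sigma>)) \<le> norm (exp (cmod a * t) * cmod (h \<sigma>))"
      proof (cases "\<sigma> \<in> {0..t}")
        case True
        have "cmod (exp (a * of_real \<sigma>)) \<le> exp (cmod (a * of_real \<sigma>))" by (rule norm_exp)
        also have "\<dots> \<le> exp (cmod a * t)" using True by (auto simp: norm_mult intro!: mult_left_mono)
        finally show ?thesis using True by (simp add: norm_mult mult_right_mono)
      qed simp
    qed
  qed measurable
  have I2: "(LBINT s. E s * P s) = (exp (a * of_real t) * P t -
     (LBINT \<sigma>. indicator {0..t} \<sigma> *\<^sub>R (exp (a * of_real \<sigma>) * h \<sigma>))) / a"
  proof -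
    have "(LBINT s. E s * P s) = (LBINT s. (LBINT \<sigma>. f s \<sigma>))" by (simp add: f1)
    also have "\<dots> = (LBINT \<sigma>. (LBINT s. f s \<sigma>))"
      by (rule lborel_pair.Fubini_integral[symmetric, OF intf])
    also have "\<dots> = (LBINT \<sigma>. (exp (a * of_real t) * (indicator {0..t} \<sigma> *\<^sub>R h \<sigma>) -
        indicator {0..t} \<sigma> *\<^sub>R (exp (a * of_real \<sigma>) * h \<sigma>)) / a)"
      unfolding f2 by (intro Bochner_Integration.integral_cong refl) (simp add: field_simps indicator_def a)
    also have "\<dots> = (exp (a * of_real t) * P t -
        (LBINT \<sigma>. indicator {0..t} \<sigma> *\<^sub>R (exp (a * of_real \<sigma>) * h \<sigma>))) / a"
      unfolding P_def
      by (simp only: integral_divide_zero integral_mult_right_zero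
          Bochner_Integration.integral_diff[OF integrable_mult_right[OF int1] int2])
    finally show ?thesis .
  qed
  have I1: "(LBINT s. E s * c0) = (exp (a * of_real t) - 1) / a * c0"
  proof -
    have "(LBINT s. E s) = (exp (a * of_real t) - 1) / a"
      using integral_exp_interval[OF a t] by (simp add: E_def)
    moreover have "(LBINT s. E s * c0) = (LBINT s. E s) * c0"
      by (rule integral_mult_left_zero)
    ultimately show ?thesis by (simp only:)
  qed
  have "(LBINT s. indicator {0..t} s *\<^sub>R (exp (a * of_real s) * (c0 + P s))) = (LBINT s. E s * c0 + E s * P s)"
    by (intro Bochner_Integration.integral_cong refl) (simp add: E_def distrib_left scaleR_add_right)
  also have "\<dots> = (LBINT s. E s * c0) + (LBINT s. E s * P s)"
    using intE lborel_pair.integrable_fst[OF intf] by (intro Bochner_Integration.integral_add) (auto simp: f1)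
  finally have sum: "(LBINT s. indicator {0..t} s *\<^sub>R (exp (a * of_real s) * (c0 + P s))) =
      (LBINT s. E s * c0) + (LBINT s. E s * P s)" .
  show ?thesis
    unfolding sum I1 I2 using a by (simp add: field_simps)
qed

lemma completion_ex_borel_measurable_complex:
  fixes u :: "'a \<Rightarrow> complex"
  assumes u: "u \<in> borel_measurable (completion M)"
  obtains v where "v \<in> borel_measurable M" "AE x in M. u x = v x"
proof -
  from u have "(\<lambda>x. Re (u x)) \<in> borel_measurable (completion M)" "(\<lambda>x. Im (u x)) \<in> borel_measurable (completion M)"
    by measurable
  from this[THEN completion_ex_borel_measurable_real] obtain p q where
    [measurable]: "p \<in> borel_measurable M" "q \<in> borel_measurable M" and
    ae: "AE x in M. Re (u x) = p x" "AE x in M. Im (u x) = q x"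
    by blast
  show ?thesis
  proof
    show "(\<lambda>x. of_real (p x) + \<i> * of_real (q x)) \<in> borel_measurable M" by measurable
    show "AE x in M. u x = of_real (p x) + \<i> * of_real (q x)"
      using ae by eventually_elim (simp add: complex_eq_iff)
  qed
qed

text \<open>The theorems on product measures concern Borel measurable functions. Replacing \<open>g'\<close> by a Borel function equal to
  it almost everywhere on \<open>[0, T]\<close> and zero outside changes none of the integrals, and being square
  integrable on a bounded interval it is integrable.\<close>
lemma has_H1_derivative_borel_representative:
  assumes H1: "has_H1_derivative T g g'"
  obtains h where "integrable lborel h" "integrable lborel (\<lambda>s. (cmod (h s))\<^sup>2)"
    "\<And>c t. \<lbrakk>c \<in> borel_measurable borel; t \<in> {0..T}\<rbrakk> \<Longrightarrow>
       (LINT s:{0..t}|lebesgue. c s * g' s) = (LBINT s. indicator {0..t} s *\<^sub>R (c s * h s))"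
    "\<And>t. t \<in> {0..T} \<Longrightarrow> g t = g 0 + (LBINT s. indicator {0..t} s *\<^sub>R h s)"
proof -
  define u where "u s = indicator {0..T} s *\<^sub>R g' s" for s
  have u_meas: "u \<in> borel_measurable lebesgue"
    using H1 unfolding has_H1_derivative_def set_borel_measurable_def u_def by blast
  have u_sq: "integrable lebesgue (\<lambda>s. (cmod (u s))\<^sup>2)"
  proof -
    have "(\<lambda>s. (cmod (u s))\<^sup>2) = (\<lambda>s. indicator {0..T} s *\<^sub>R (cmod (g' s))\<^sup>2)"
      by (auto simp: u_def indicator_def)
    then show ?thesis using H1 unfolding has_H1_derivative_def set_integrable_def by simp
  qed
  obtain v where v_meas: "v \<in> borel_measurable lborel" and v: "AE s in lborel. u s = v s"
    by (rule completion_ex_borel_measurable_complex[OF u_meas], rule that)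
  have [measurable]: "v \<in> borel_measurable borel" using v_meas by simp
  define h where "h s = indicator {0..T} s *\<^sub>R v s" for s
  have h_meas[measurable]: "h \<in> borel_measurable borel" unfolding h_def by measurable
  have uh: "AE s in lborel. u s = h s"
    using v
  proof eventually_elim
    case (elim s)
    have "u s = indicator {0..T} s *\<^sub>R u s" by (simp add: u_def indicator_def)
    then show ?case unfolding h_def elim .
  qed
  then have uh': "AE s in lebesgue. u s = h s" by (rule AE_completion)
  have h2: "integrable lborel (\<lambda>s. (cmod (h s))\<^sup>2)"
  proof -
    have "integrable lebesgue (\<lambda>s. (cmod (h s))\<^sup>2)"
    proof (rule integrable_cong_AE_imp[OF u_sq])
      show "(\<lambda>s. (cmod (h s))\<^sup>2) \<in> borel_measurable lebesgue"
        by (rule measurable_completion) measurable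
      show "AE s in lebesgue. (cmod (u s))\<^sup>2 = (cmod (h s))\<^sup>2"
        using uh' by eventually_elim simp
    qed
    then show ?thesis by (subst (asm) integrable_completion) auto
  qed
  have h1: "integrable lborel h"
  proof (rule Bochner_Integration.integrable_bound)
    show "integrable lborel (\<lambda>s. indicator {0..T} s + (cmod (h s))\<^sup>2)"
      by (intro Bochner_Integration.integrable_add integrable_real_indicator h2) (auto simp: emeasure_lborel_Icc_eq)
    show "AE s in lborel. norm (h s) \<le> norm (indicator {0..T} s + (cmod (h s))\<^sup>2)"
    proof (rule AE_I2)
      fix s
      have "2 * cmod (h s) \<le> 1 + (cmod (h s))\<^sup>2"
        using sum_squares_bound[of 1 "cmod (h s)"] by simp
      with norm_ge_zero[of "h s"] have "cmod (h s) \<le> 1 + (cmod (h s))\<^sup>2" by linarith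
      then show "norm (h s) \<le> norm (indicator {0..T} s + (cmod (h s))\<^sup>2)"
        by (cases "s \<in> {0..T}") (auto simp: h_def)
    qed
  qed simp
  have eq: "(LINT s:{0..t}|lebesgue. c s * g' s) = (LBINT s. indicator {0..t} s *\<^sub>R (c s * h s))"
    if [measurable]: "c \<in> borel_measurable borel" and t: "t \<in> {0..T}" for c t
  proof -
    have c: "(\<lambda>s. indicator {0..t} s *\<^sub>R c s) \<in> borel_measurable lebesgue"
      by (rule measurable_completion) measurable
    have "(LINT s:{0..t}|lebesgue. c s * g' s) = (LINT s|lebesgue. (indicator {0..t} s *\<^sub>R c s) * u s)"
      unfolding set_lebesgue_integral_def using t
      by (intro Bochner_Integration.integral_cong) (auto simp: u_def indicator_def)
    also have "\<dots> = (LINT s|lebesgue. (indicator {0..t} s *\<^sub>R c s) * h s)"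
    proof (rule integral_cong_AE)
      show "(\<lambda>s. (indicator {0..t} s *\<^sub>R c s) * u s) \<in> borel_measurable lebesgue"
        by (intro borel_measurable_times c u_meas)
      show "(\<lambda>s. (indicator {0..t} s *\<^sub>R c s) * h s) \<in> borel_measurable lebesgue"
        by (rule measurable_completion) measurable
      show "AE s in lebesgue. (indicator {0..t} s *\<^sub>R c s) * u s = (indicator {0..t} s *\<^sub>R c s) * h s"
        using uh' by eventually_elim simp
    qed
    also have "\<dots> = (LBINT s. (indicator {0..t} s *\<^sub>R c s) * h s)"
      by (rule integral_completion) measurable
    finally show ?thesis by simp
  qed
  have g_eq: "g t = g 0 + (LBINT s. indicator {0..t} s *\<^sub>R h s)" if t: "t \<in> {0..T}" for t
  proof -
    have "g t = g 0 + (LINT s:{0..t}|lebesgue. g' s)"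
      using H1 t unfolding has_H1_derivative_def by blast
    also have "(LINT s:{0..t}|lebesgue. g' s) = (LINT s:{0..t}|lebesgue. 1 * g' s)"
      by (simp only: mult_1)
    also have "(LINT s:{0..t}|lebesgue. 1 * g' s) = (LBINT s. indicator {0..t} s *\<^sub>R (1 * h s))"
      by (rule eq[of "\<lambda>_. 1", OF borel_measurable_const t])
    finally show ?thesis by simp
  qed
  show thesis
  proof (rule that[OF h1 h2])
    show "(LINT s:{0..t}|lebesgue. c s * g' s) = (LBINT s. indicator {0..t} s *\<^sub>R (c s * h s))"
      if "c \<in> borel_measurable borel" "t \<in> {0..T}" for c t
      using that by (rule eq)
    show "g t = g 0 + (LBINT s. indicator {0..t} s *\<^sub>R h s)" if "t \<in> {0..T}" for t
      using that by (rule g_eq)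
  qed
qed

lemma lebesgue_integral_eq_lborel:
  fixes g h c :: "real \<Rightarrow> complex" and t :: real and c0 :: complex
  assumes g: "\<And>s. s \<in> {0..t} \<Longrightarrow> g s = c0 + (LBINT \<sigma>. indicator {0..s} \<sigma> *\<^sub>R h \<sigma>)"
    and [measurable]: "h \<in> borel_measurable borel" "c \<in> borel_measurable borel"
  shows "(LINT s:{0..t}|lebesgue. c s * g s) =
    (LBINT s. indicator {0..t} s *\<^sub>R (c s * (c0 + (LBINT \<sigma>. indicator {0..s} \<sigma> *\<^sub>R h \<sigma>))))"
proof -
  have eq: "(LBINT \<sigma>. indicator {0..s} \<sigma> *\<^sub>R h \<sigma>) = (LBINT \<sigma>. if 0 \<le> \<sigma> \<and> \<sigma> \<le> s then h \<sigma> else 0)" for s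
    by (intro Bochner_Integration.integral_cong) (auto simp: indicator_def)
  have "(\<lambda>s. LBINT \<sigma>. if 0 \<le> \<sigma> \<and> \<sigma> \<le> s then h \<sigma> else 0) \<in> borel_measurable lborel"
    by (rule lborel.borel_measurable_lebesgue_integral[where f = "\<lambda>s \<sigma>. if 0 \<le> \<sigma> \<and> \<sigma> \<le> s then h \<sigma> else 0"]) measurable
  then have [measurable]: "(\<lambda>s. LBINT \<sigma>. indicator {0..s} \<sigma> *\<^sub>R h \<sigma>) \<in> borel_measurable borel"
    unfolding eq by simp
  have "(LINT s:{0..t}|lebesgue. c s * g s) =
    (LINT s|lebesgue. indicator {0..t} s *\<^sub>R (c s * (c0 + (LBINT \<sigma>. indicator {0..s} \<sigma> *\<^sub>R h \<sigma>))))"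
    unfolding set_lebesgue_integral_def using g
    by (intro Bochner_Integration.integral_cong) (auto simp: indicator_def)
  also have "\<dots> = (LBINT s. indicator {0..t} s *\<^sub>R (c s * (c0 + (LBINT \<sigma>. indicator {0..s} \<sigma> *\<^sub>R h \<sigma>))))"
    by (rule integral_completion) measurable
  finally show ?thesis .
qed

section \<open>The expansion\<close>

theorem mainTheorem4:
  fixes R T :: real and g0 g0' :: "real \<Rightarrow> complex" and s \<tau> :: real
  assumes "R > 0" and "T > 0"
    and "has_H1_derivative T g0 g0'"
    and "(s, \<tau>) \<in> closure ({0<..} \<times> {0<..<T})"
  shows "(\<forall>x>0. \<forall>t\<in>{0<..T}.
            D1_convergent R (q_integrand g0 x t) \<and>
            D1_convergent R (I_integrand x t) \<and>
            D1_convergent R (G_integrand g0' t s \<tau>)) \<and>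
         (\<lambda>(x, t). cmod (q_sol R g0 x t -
              (- 2 * g0 0 * I_omega_0_1 R x t
               - 1 / of_real pi * D1_integral R (G_integrand g0' t s \<tau>))))
         \<in> O[inf (nhds (s, \<tau>)) (principal ({0<..} \<times> {0<..T}))](
            \<lambda>(x, t). \<bar>x - s\<bar> powr (1/2) + \<bar>t - \<tau>\<bar> powr (1/4))"
proof -
  note R = \<open>R > 0\<close>
  have s\<tau>: "s \<ge> 0" "\<tau> \<in> {0..T}"
    using assms(2,4) by (auto simp: closure_Times)
  obtain h where h: "integrable lborel h" "integrable lborel (\<lambda>s. (cmod (h s))\<^sup>2)"
    and g0'_eq: "\<And>c t. \<lbrakk>c \<in> borel_measurable borel; t \<in> {0..T}\<rbrakk> \<Longrightarrow>
       (LINT s:{0..t}|lebesgue. c s * g0' s) = (LBINT s. indicator {0..t} s *\<^sub>R (c s * h s))"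
    and g0_eq: "\<And>t. t \<in> {0..T} \<Longrightarrow> g0 t = g0 0 + (LBINT s. indicator {0..t} s *\<^sub>R h s)"
    by (rule has_H1_derivative_borel_representative[OF assms(3)], rule that)
  have h_meas[measurable]: "h \<in> borel_measurable borel" using h(1) by auto
  define N1 N2 where "N1 = (LBINT \<sigma>. cmod (h \<sigma>))" and "N2 = (LBINT \<sigma>. (cmod (h \<sigma>))\<^sup>2)"
  define C where "C = pi * exp (2 * R\<^sup>2 * T) * R powr (1/2) * N1 + 2 * (2 * pi * exp (1 / 2) * N2 + 1 / R)"
  define \<epsilon> where "\<epsilon> x t = \<bar>x - s\<bar> powr (1/2) + \<bar>t - \<tau>\<bar> powr (1/4)" for x t
  define J where "J t x t' = G_integrand g0' t x t'" for t x t'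
  have J: "y \<ge> 0 \<Longrightarrow> D1_convergent R (J t y t')"
     "x \<ge> 0 \<Longrightarrow> cmod (D1_integral R (J t x t) - D1_integral R (J t s \<tau>)) \<le> C * \<epsilon> x t"
    if t: "t \<in> {0<..T}" for x t y t'
  proof -
    define h' where "h' \<sigma> = indicator {0..t} \<sigma> *\<^sub>R h \<sigma>" for \<sigma>
    have [measurable]: "h' \<in> borel_measurable borel" unfolding h'_def by measurable
    have h': "integrable lborel h'"
      by (rule Bochner_Integration.integrable_bound[OF h(1)]) (auto simp: h'_def indicator_def)
    have h'2: "integrable lborel (\<lambda>\<sigma>. (cmod (h' \<sigma>))\<^sup>2)"
      by (rule Bochner_Integration.integrable_bound[OF h(2)]) (auto simp: h'_def indicator_def)
    have supp: "h' \<sigma> = 0" if "\<sigma> \<notin> {0..T}" for \<sigma>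
      using t that by (auto simp: h'_def indicator_def)
    have J_eq: "J t x t' = (\<lambda>k. exp (\<i> * k * of_real x - \<i> * omega k * of_real t') *
        (LBINT \<sigma>. exp (\<i> * omega k * of_real \<sigma>) * h' \<sigma>) * (1 / (\<i> * k)))" for x t'
    proof
      fix k
      have "G_0_0 g0' t k = (LBINT \<sigma>. indicator {0..t} \<sigma> *\<^sub>R (exp (\<i> * omega k * of_real \<sigma>) * h \<sigma>))"
        unfolding G_0_0_def using t by (intro g0'_eq) auto
      then show "J t x t' k = exp (\<i> * k * of_real x - \<i> * omega k * of_real t') *
        (LBINT \<sigma>. exp (\<i> * omega k * of_real \<sigma>) * h' \<sigma>) * (1 / (\<i> * k))"
        unfolding J_def G_integrand_def h'_def by simp
    qed
    show "D1_convergent R (J t y t')" if "y \<ge> 0"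
      unfolding J_eq by (rule D1_integral_G_estimates(1)[OF R h' h'2 supp that])
    have N1: "(LBINT \<sigma>. cmod (h' \<sigma>)) \<le> N1"
      unfolding N1_def by (rule integral_mono') (use h(1) in \<open>auto simp: h'_def indicator_def\<close>)
    have N2: "(LBINT \<sigma>. (cmod (h' \<sigma>))\<^sup>2) \<le> N2"
      unfolding N2_def by (rule integral_mono') (use h(2) in \<open>auto simp: h'_def indicator_def\<close>)
    assume x: "x \<ge> 0"
    have "cmod (D1_integral R (J t x t) - D1_integral R (J t s \<tau>)) \<le>
        (pi * exp (2 * R\<^sup>2 * T) * R powr (1/2) * (LBINT \<sigma>. cmod (h' \<sigma>)) +
         2 * (2 * pi * exp (1 / 2) * (LBINT \<sigma>. (cmod (h' \<sigma>))\<^sup>2) + 1 / R)) * \<epsilon> x t"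
      unfolding J_eq \<epsilon>_def
      by (rule D1_integral_G_estimates(2)[OF R h' h'2 supp x s\<tau>(1) _ s\<tau>(2)]) (use t in auto)
    also have "\<dots> \<le> C * \<epsilon> x t"
      unfolding C_def
      by (intro mult_right_mono add_mono mult_left_mono N1 N2 order_refl) (auto simp: \<epsilon>_def)
    finally show "cmod (D1_integral R (J t x t) - D1_integral R (J t s \<tau>)) \<le> C * \<epsilon> x t" .
  qed
  have q: "has_D1_integral R (q_integrand g0 x t)
      (- (2 * g0 0) * D1_integral R (I_integrand x t) - 2 * D1_integral R (J t x t))"
    if x: "x > 0" and t: "t \<in> {0<..T}" for x t
  proof -
    have "q_integrand g0 x t k = 2 * g0 t * (exp (\<i> * k * of_real x) * (1 / (\<i> * k)))
        - 2 * g0 0 * I_integrand x t k - 2 * J t x t k" if k: "k \<noteq> 0" for k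
    proof -
      define a where "a = \<i> * omega k"
      have a: "a \<noteq> 0" using k by (simp add: a_def omega_def)
      have ak: "2 * k = 2 * a * (1 / (\<i> * k))" using k by (simp add: a_def omega_def power2_eq_square)
      have gt: "g_tilde g0 (- omega k) t = (LBINT \<sigma>. indicator {0..t} \<sigma> *\<^sub>R
          (exp (a * of_real \<sigma>) * (g0 0 + (LBINT \<sigma>'. indicator {0..\<sigma>} \<sigma>' *\<^sub>R h \<sigma>'))))"
        unfolding g_tilde_def a_def using t
        by (subst lebesgue_integral_eq_lborel[where h = h and ?c0.0 = "g0 0"]) (auto intro!: g0_eq)
      have G: "G_0_0 g0' t k = (LBINT \<sigma>. indicator {0..t} \<sigma> *\<^sub>R (exp (a * of_real \<sigma>) * h \<sigma>))"
        unfolding G_0_0_def a_def using t by (intro g0'_eq) auto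
      have parts: "a * g_tilde g0 (- omega k) t = exp (a * of_real t) * g0 t - g0 0 - G_0_0 g0' t k"
        using integration_by_parts_exp[OF a _ h(1), of t "g0 0"] t g0_eq[of t] unfolding gt G by simp
      \<comment> \<open>\<open>e\<close> is the exponential common to the three parts; it cancels only against the term with \<open>g0 t\<close>.\<close>
      define e where "e = exp (\<i> * k * of_real x - a * of_real t)"
      have IJ: "I_integrand x t k = e * (1 / (\<i> * k))" "J t x t k = e * G_0_0 g0' t k * (1 / (\<i> * k))"
        by (simp_all add: I_integrand_def J_def G_integrand_def e_def a_def)
      have "q_integrand g0 x t k = e *
          (2 * (a * g_tilde g0 (- omega k) t) * (1 / (\<i> * k)))"
        unfolding q_integrand_def ak by (simp add: e_def a_def mult_ac)
      also have "\<dots> = 2 * g0 t * ((e * exp (a * of_real t)) * (1 / (\<i> * k)))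
        - 2 * g0 0 * I_integrand x t k - 2 * J t x t k"
        unfolding parts IJ by (simp add: algebra_simps)
      also have "e * exp (a * of_real t) = exp (\<i> * k * of_real x)"
        by (simp add: e_def flip: exp_add)
      finally show ?thesis .
    qed
    moreover have "has_D1_integral R (\<lambda>k. 2 * g0 t * (exp (\<i> * k * of_real x) * (1 / (\<i> * k)))
        - 2 * g0 0 * I_integrand x t k - 2 * J t x t k)
        (2 * g0 t * 0 - 2 * g0 0 * D1_integral R (I_integrand x t) - 2 * D1_integral R (J t x t))"
      using x t R
      by (intro has_D1_integral_diff has_D1_integral_cmult has_D1_integral_exp_over_k
          D1_convergent_imp_has_D1_integral D1_convergent_I_integrand J) auto
    ultimately show ?thesis
      using has_D1_integral_cong[OF R] by simp
  qed
  show ?thesis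
  proof (intro conjI allI impI ballI)
    fix x t :: real assume x: "x > 0" and t: "t \<in> {0<..T}"
    show "D1_convergent R (q_integrand g0 x t)" by (rule has_D1_integralD(1)[OF q[OF x t]])
    show "D1_convergent R (I_integrand x t)" using R x t by (intro D1_convergent_I_integrand) auto
    show "D1_convergent R (G_integrand g0' t s \<tau>)" using J(1)[OF t s\<tau>(1)] unfolding J_def .
  next
    have "cmod (q_sol R g0 x t - (- 2 * g0 0 * I_omega_0_1 R x t
        - 1 / of_real pi * D1_integral R (G_integrand g0' t s \<tau>))) \<le> C * \<epsilon> x t"
      if x: "x > 0" and t: "t \<in> {0<..T}" for x t
    proof -
      have "q_sol R g0 x t - (- 2 * g0 0 * I_omega_0_1 R x t
        - 1 / of_real pi * D1_integral R (G_integrand g0' t s \<tau>)) =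
        - (1 / of_real pi) * (D1_integral R (J t x t) - D1_integral R (J t s \<tau>))"
        unfolding q_sol_def has_D1_integralD(2)[OF q[OF x t]] I_omega_0_1_def J_def
        by (simp add: field_simps)
      then have "cmod (q_sol R g0 x t - (- 2 * g0 0 * I_omega_0_1 R x t
        - 1 / of_real pi * D1_integral R (G_integrand g0' t s \<tau>))) = 
        (1 / pi) * cmod (D1_integral R (J t x t) - D1_integral R (J t s \<tau>))"
        by (simp only: norm_mult norm_minus_cancel norm_divide norm_one norm_of_real abs_of_pos pi_gt_zero)
      also have "\<dots> \<le> 1 * cmod (D1_integral R (J t x t) - D1_integral R (J t s \<tau>))"
        using pi_gt3 by (intro mult_right_mono) auto
      also have "\<dots> \<le> C * \<epsilon> x t" using J(2)[OF t] x by simp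
      finally show ?thesis .
    qed
    then show "(\<lambda>(x, t). cmod (q_sol R g0 x t -
              (- 2 * g0 0 * I_omega_0_1 R x t
               - 1 / of_real pi * D1_integral R (G_integrand g0' t s \<tau>))))
         \<in> O[inf (nhds (s, \<tau>)) (principal ({0<..} \<times> {0<..T}))](
            \<lambda>(x, t). \<bar>x - s\<bar> powr (1/2) + \<bar>t - \<tau>\<bar> powr (1/4))"
      by (intro bigoI[where c = C], unfold eventually_inf_principal, intro always_eventually)
         (auto simp: \<epsilon>_def)
  qed
qed

end
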